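(* Suppose that Assumptions (A1)–(A7) hold. Then there exists $\epsilon_0>0$ such that for every $\epsilon$ with $0<\epsilon<\epsilon_0$, Problem 1 (with this $\epsilon$) admits a solution $(u,m)$ with $u,m\in C^{2,\frac12}(\mathbb{T})$ and $m>0$ on $\mathbb{T}$.
   Context: Let $\mathbb{T}=\mathbb{R}/\mathbb{Z}$ be the one-dimensional torus; functions on $\mathbb{T}$ are identified with $1$-periodic functions on $\mathbb{R}$, and integrals over $\mathbb{T}$ are written $\int_0^1$. $C^{k,\frac12}(\mathbb{T})$ denotes the functions of class $C^k$ on $\mathbb{T}$ whose $k$-th derivative is $\frac12$-Hölder continuous. Let $H:\mathbb{R}\to\mathbb{R}$ be of class $C^2$, $V:\mathbb{T}\to\mathbb{R}$ continuous, $\alpha>0$, and $0<\epsilon\le 1$. We say $(u,m)$ solves Problem 1 if $u,m\in C^2(\mathbb{T})$, $m>0$ on $\mathbb{T}$, and on $\mathbb{T}$: $$u-u_{xx}+H(u_x)+V(x)=m^\alpha+\epsilon(m-m_{xx}),\qquad m-m_{xx}-(H'(u_x)m)_x=1-\epsilon(u-u_{xx}).$$ Assumptions: (A1) there exist constants $C_1,C_2,C_3>0$ and $\gamma>1$ such that $-C_1+C_2|p|^\gamma\le H(p)\le C_1+C_3|p|^\gamma$ for all $p\in\mathbb{R}$. (A2) There exist constants $\tilde C_1,\tilde C_2,\tilde C_3>0$ such that $-\tilde C_1+\tilde C_2|p|^\gamma\le pH'(p)-H(p)\le \tilde C_1+\tilde C_3|p|^\gamma$ for all $p$ (same $\gamma$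 as in (A1)). (A3) $V$ is of class $C^2$. (A4) $H$ is convex. (A5) $H$ is of class $C^4$. (A6) $\gamma<2$. (A7) There exists $\bar C>0$ with $|H'(p)|\le \bar C(1+|p|^{\gamma-1})$ for all $p$. *)

theory Defs
  imports "HOL-Analysis.Analysis"
begin

text \<open>Functions on the torus R/Z are identified with 1-periodic functions on R.\<close>
definition periodic1 :: "(real \<Rightarrow> real) \<Rightarrow> bool" where
  "periodic1 f \<longleftrightarrow> (\<forall>x. f (x + 1) = f x)"

definition C_k :: "nat \<Rightarrow> (real \<Rightarrow> real) \<Rightarrow> bool" where
  "C_k k f \<longleftrightarrow> (\<forall>j<k. \<forall>x. ((deriv ^^ j) f) differentiable (at x))
                 \<and> continuous_on UNIV ((deriv ^^ k) f)"

text \<open>1/2-Hoelder continuity (for periodic functions equivalent to Hoelder on the torus).\<close>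
definition holder_half :: "(real \<Rightarrow> real) \<Rightarrow> bool" where
  "holder_half g \<longleftrightarrow> (\<exists>C. \<forall>x y. \<bar>g x - g y\<bar> \<le> C * \<bar>x - y\<bar> powr (1/2))"

definition C_k_half_T :: "nat \<Rightarrow> (real \<Rightarrow> real) \<Rightarrow> bool" where
  "C_k_half_T k f \<longleftrightarrow> periodic1 f \<and> C_k k f \<and> holder_half ((deriv ^^ k) f)"

definition solves_problem1 ::
  "(real \<Rightarrow> real) \<Rightarrow> (real \<Rightarrow> real) \<Rightarrow> real \<Rightarrow> real \<Rightarrow> (real \<Rightarrow> real) \<Rightarrow> (real \<Rightarrow> real) \<Rightarrow> bool" where
  "solves_problem1 H V \<alpha> \<epsilon> u m \<longleftrightarrow>
     periodic1 u \<and> periodic1 m \<and> C_k 2 u \<and> C_k 2 m \<and> (\<forall>x. m x > 0) \<and>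
     (\<forall>x. u x - deriv (deriv u) x + H (deriv u x) + V x
            = m x powr \<alpha> + \<epsilon> * (m x - deriv (deriv m) x)) \<and>
     (\<forall>x. m x - deriv (deriv m) x - deriv (\<lambda>y. deriv H (deriv u y) * m y) x
            = 1 - \<epsilon> * (u x - deriv (deriv u) x))"

end

theory Submission
  imports Defs
begin

text \<open>
  Put \<open>a = u - \<epsilon> m\<close> and \<open>b = m + \<epsilon> u\<close>. The system becomes
  \<open>a - a'' = f\<close>, \<open>(b' + g)' = b - 1\<close> with \<open>f = m\<^sup>\<alpha> - H(u') - V\<close> and
  \<open>g = m H'(u')\<close>, where \<open>u'\<close> is a function of \<open>m\<close>, \<open>a'\<close> and \<open>b' + g\<close>
  because \<open>H'\<close> is monotone. After truncating \<open>m\<close> and \<open>u'\<close> in \<open>f\<close> and \<open>g\<close>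
  this is a bounded Lipschitz perturbation of a hyperbolic linear equation in four dimensions,
  which has a periodic solution by Brouwer's theorem applied to the time-one map.

  A maximum principle gives \<open>m \<ge> 0\<close> for small \<open>\<epsilon>\<close>. Testing the equations with
  \<open>m - 1\<close> and \<open>u\<close>, and using \<open>p H'(p) - H(p) \<ge> |H'(p)| - C\<close> (convexity),
  one bounds \<open>f\<close> and \<open>g\<close> in \<open>L\<^sup>1\<close>, uniformly in \<open>\<epsilon>\<close> and in the truncation;
  this bounds \<open>a, a', b, b' + g\<close>, hence \<open>m\<close> and \<open>u'\<close>, so the truncation at high values
  is inactive. At a minimum of \<open>m\<close> the second equation then bounds \<open>m\<close> from below by a constant
  not depending on the lower truncation of \<open>m\<close>, which is therefore inactive as well.
\<close>

subsection \<open>Ordinary differential equations\<close>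

text \<open>Mean value inequality adapted to forward solutions, whose derivative at 0 is one-sided;
  at positive times \<open>at t within {0..}\<close> equals \<open>at t\<close>.\<close>

lemma norm_increment_le_on_half_line:
  fixes f :: "real \<Rightarrow> 'a::real_normed_vector"
  assumes "0 \<le> x"
    and f: "\<And>t. 0 \<le> t \<Longrightarrow> (f has_vector_derivative f' t) (at t within {0..})"
    and g: "\<And>t. (g has_real_derivative g' t) (at t)"
    and le: "\<And>t. 0 \<le> t \<Longrightarrow> norm (f' t) \<le> g' t"
  shows "norm (f x - f 0) \<le> g x - g 0"
proof (cases "x = 0")
  case False
  then have x: "0 < x" using assms(1) by simp
  show ?thesis
  proof (rule differentiable_bound_general[OF x])
    show "continuous_on {0..x} f"
      by (rule continuous_on_subset[OF continuous_on_vector_derivative[of "{0..}" f f']]) (use f in auto)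
    show "continuous_on {0..x} g"
      using g by (meson DERIV_isCont continuous_at_imp_continuous_on)
    fix t assume t: "0 < t" "t < x"
    have "at t within {0..} = at t"
      using t by (intro at_within_interior) simp
    then show "(f has_vector_derivative f' t) (at t)"
      using f[of t] t by simp
    show "(g has_vector_derivative g' t) (at t)"
      using g by (simp add: has_real_derivative_iff_has_vector_derivative)
    show "norm (f' t) \<le> g' t" using le t by simp
  qed
qed simp

text \<open>Picard iteration in the supremum norm weighted by \<open>exp (- K t)\<close>: for large
  \<open>K\<close> the integral operator is a contraction on the entire half-line at once, without
  gluing local solutions. The bound on \<open>F t 0\<close> keeps the iterates in the weighted
  space.\<close>

lemma global_ivp_exists:
  fixes F :: "real \<Rightarrow> 'a::euclidean_space \<Rightarrow> 'a"
  assumes cont: "continuous_on UNIV (\<lambda>(t, y). F t y)"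
    and lip: "\<And>t x y. norm (F t x - F t y) \<le> L * norm (x - y)"
    and bd: "\<And>t. norm (F t 0) \<le> B"
    and "0 \<le> L"
  shows "\<exists>y. y 0 = y0 \<and> (\<forall>t\<ge>0. (y has_vector_derivative F t (y t)) (at t within {0..}))"
proof -
  \<comment> \<open>The contraction factor will be \<open>L / K\<close>; the summand 1 keeps
    \<open>K\<close> positive when \<open>L = 0\<close>.\<close>
  define K where "K = 2 * L + 1"
  have K: "K > 0" and LK: "L / K \<le> 1/2" using \<open>0 \<le> L\<close> by (auto simp: K_def field_simps)
  have B0: "0 \<le> B" using bd[of 0] norm_ge_zero order_trans by blast
  define I where "I v x = integral {0..x} (\<lambda>t. F t (exp (K * t) *\<^sub>R v t))" for v x
  have contF: "continuous_on S (\<lambda>t. F t (exp (K * t) *\<^sub>R v t))"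
    if "continuous_on UNIV v" for v :: "real \<Rightarrow> 'a" and S
  proof -
    have "continuous_on S (\<lambda>t. (t, exp (K * t) *\<^sub>R v t))"
      by (intro continuous_intros continuous_on_subset[OF that]) auto
    from continuous_on_compose2[OF cont this] show ?thesis by auto
  qed
  have I_deriv: "(I v has_vector_derivative F x (exp (K * x) *\<^sub>R v x)) (at x within {0..})"
    if v: "continuous_on UNIV v" and x: "0 \<le> x" for v :: "real \<Rightarrow> 'a" and x
  proof -
    have "(I v has_vector_derivative F x (exp (K * x) *\<^sub>R v x)) (at x within {0..x+1})"
      unfolding I_def using integral_has_vector_derivative[OF contF[OF v], of x 0 "x+1"] x by simp
    moreover have "at x within {0..x+1} = at x within {0..}"
      by (rule at_within_nhd[of x "{..<x+1}"]) auto
    ultimately show ?thesis by simp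
  qed
  have I0: "I v 0 = 0" for v by (simp add: I_def)
  have I_cont: "continuous_on UNIV (\<lambda>x. I v (max 0 x))" if v: "continuous_on UNIV v" for v :: "real \<Rightarrow> 'a"
  proof -
    have "continuous_on {0..} (I v)"
      by (rule continuous_on_vector_derivative, rule I_deriv[OF v]) simp
    moreover have "continuous_on UNIV (\<lambda>x::real. max 0 x)" by (intro continuous_intros)
    ultimately show ?thesis by (rule continuous_on_compose2) auto
  qed
  have exp_deriv: "((\<lambda>t. (c / K) * exp (K * t)) has_real_derivative c * exp (K * t)) (at t)" for c t
    using K by (auto intro!: derivative_eq_intros)
  have I_bound: "norm (I v x) \<le> (B + L * C) / K * exp (K * x)"
    if v: "continuous_on UNIV v" and C: "\<And>t. norm (v t) \<le> C" and x: "0 \<le> x" for v :: "real \<Rightarrow> 'a" and C x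
  proof -
    have C0: "0 \<le> C" using C[of 0] norm_ge_zero order_trans by blast
    have le: "norm (F t (exp (K * t) *\<^sub>R v t)) \<le> (B + L * C) * exp (K * t)" if t: "0 \<le> t" for t
    proof -
      have "norm (F t (exp (K * t) *\<^sub>R v t)) \<le> norm (F t 0) + norm (F t (exp (K * t) *\<^sub>R v t) - F t 0)"
        by (rule norm_triangle_sub)
      also have "\<dots> \<le> B + L * norm (exp (K * t) *\<^sub>R v t - 0)"
        using bd[of t] lip[of t "exp (K * t) *\<^sub>R v t" 0] by simp
      also have "\<dots> \<le> B * exp (K * t) + L * (exp (K * t) * C)"
        using B0 \<open>0 \<le> L\<close> K t C[of t] by (intro add_mono mult_left_mono) (auto simp: mult_le_cancel_left1)
      finally show ?thesis by (simp add: algebra_simps)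
    qed
    have "norm (I v x - I v 0) \<le> (B + L * C) / K * exp (K * x) - (B + L * C) / K * exp (K * 0)"
      using x I_deriv[OF v] exp_deriv le by (rule norm_increment_le_on_half_line)
    also have "\<dots> \<le> (B + L * C) / K * exp (K * x)" using K B0 C0 \<open>0 \<le> L\<close> by simp
    finally show ?thesis by (simp add: I0)
  qed
  have I_lip: "norm (I v x - I v' x) \<le> L * D / K * exp (K * x)"
    if v: "continuous_on UNIV v" "continuous_on UNIV v'" and D: "\<And>t. norm (v t - v' t) \<le> D" and x: "0 \<le> x"
    for v v' :: "real \<Rightarrow> 'a" and D x
  proof -
    have D0: "0 \<le> D" using D[of 0] norm_ge_zero order_trans by blast
    have le: "norm (F t (exp (K * t) *\<^sub>R v t) - F t (exp (K * t) *\<^sub>R v' t)) \<le> (L * D) * exp (K * t)" if t: "0 \<le> t" for t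
    proof -
      have "norm (F t (exp (K * t) *\<^sub>R v t) - F t (exp (K * t) *\<^sub>R v' t)) \<le> L * norm (exp (K * t) *\<^sub>R (v t - v' t))"
        using lip[of t "exp (K * t) *\<^sub>R v t" "exp (K * t) *\<^sub>R v' t"] by (simp add: scaleR_diff_right)
      also have "\<dots> \<le> L * (exp (K * t) * D)"
        using \<open>0 \<le> L\<close> D[of t] by (intro mult_left_mono) auto
      finally show ?thesis by (simp add: algebra_simps)
    qed
    have der: "((\<lambda>x. I v x - I v' x) has_vector_derivative
        F t (exp (K * t) *\<^sub>R v t) - F t (exp (K * t) *\<^sub>R v' t)) (at t within {0..})" if "0 \<le> t" for t
      using I_deriv[OF v(1) that] I_deriv[OF v(2) that] by (rule has_vector_derivative_diff)
    have "norm ((I v x - I v' x) - (I v 0 - I v' 0)) \<le> (L * D) / K * exp (K * x) - (L * D) / K * exp (K * 0)"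
      using norm_increment_le_on_half_line[OF x der exp_deriv le] by simp
    also have "\<dots> \<le> (L * D) / K * exp (K * x)" using K D0 \<open>0 \<le> L\<close> by simp
    finally show ?thesis by (simp add: I0)
  qed
  \<comment> \<open>The Picard operator for the rescaled unknown
    \<open>v t = exp (- K t) y t\<close>. Freezing the argument at 0 for negative \<open>x\<close>
    makes it act on the complete space of bounded continuous functions on the whole line.\<close>
  define T where "T v x = exp (- (K * max 0 x)) *\<^sub>R (y0 + I v (max 0 x))" for v x
  have T_in: "T v \<in> bcontfun" if v: "v \<in> bcontfun" for v
  proof -
    have cv: "continuous_on UNIV v" using v by (simp add: bcontfun_def)
    obtain C where C: "\<And>t. norm (v t) \<le> C" using v by (auto simp: bcontfun_def bounded_iff)
    have "norm (T v x) \<le> norm y0 + (B + L * C) / K" for x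
    proof -
      define s where "s = max 0 x"
      have s: "0 \<le> s" by (simp add: s_def)
      have "norm (T v x) \<le> exp (- (K * s)) * (norm y0 + norm (I v s))"
        by (simp add: T_def s_def[symmetric] norm_triangle_ineq)
      also have "\<dots> \<le> exp (- (K * s)) * (norm y0 + (B + L * C) / K * exp (K * s))"
        using I_bound[OF cv C s] by (intro mult_left_mono add_mono) auto
      also have "\<dots> = exp (- (K * s)) * norm y0 + (B + L * C) / K"
        by (simp add: algebra_simps exp_minus_inverse)
      also have "exp (- (K * s)) * norm y0 \<le> 1 * norm y0"
        using K s by (intro mult_right_mono) auto
      finally show ?thesis by simp
    qed
    moreover have "continuous_on UNIV (T v)"
      unfolding T_def by (intro continuous_intros I_cont[OF cv])
    ultimately show ?thesis by (rule bcontfun_normI[rotated])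
  qed
  define TC where "TC v = Bcontfun (T (apply_bcontfun v))" for v :: "real \<Rightarrow>\<^sub>C 'a"
  have TC: "apply_bcontfun (TC v) = T (apply_bcontfun v)" for v
    unfolding TC_def by (intro Bcontfun_inverse T_in apply_bcontfun)
  have "\<exists>!v. TC v = v"
  proof (rule banach_fix_type[of "1/2"]; (intro allI)?)
    fix v v' :: "real \<Rightarrow>\<^sub>C 'a"
    show "dist (TC v) (TC v') \<le> 1/2 * dist v v'"
    proof (rule dist_bound)
      fix x :: real
      define s where "s = max 0 x"
      have s: "0 \<le> s" by (simp add: s_def)
      have D: "norm (apply_bcontfun v t - apply_bcontfun v' t) \<le> dist v v'" for t
        using dist_bounded[of v t v'] by (simp add: dist_norm)
      have "dist (apply_bcontfun (TC v) x) (apply_bcontfun (TC v') x)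
          = exp (- (K * s)) * norm (I v s - I v' s)"
        by (simp add: TC T_def s_def[symmetric] dist_norm scaleR_diff_right[symmetric])
      also have "\<dots> \<le> exp (- (K * s)) * (L * dist v v' / K * exp (K * s))"
        using I_lip[OF _ _ D s] by (intro mult_left_mono) auto
      also have "\<dots> = (L / K) * dist v v'" by (simp add: exp_minus)
      also have "\<dots> \<le> 1/2 * dist v v'" using LK by (intro mult_right_mono) auto
      finally show "dist (apply_bcontfun (TC v) x) (apply_bcontfun (TC v') x) \<le> 1/2 * dist v v'" .
    qed
  qed auto
  then obtain v where v: "TC v = v" by auto
  have vc: "continuous_on UNIV (apply_bcontfun v)" by simp
  define y where "y x = y0 + I v x" for x
  have vy: "exp (K * x) *\<^sub>R v x = y x" if "0 \<le> x" for x
  proof -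
    have "v x = T v x" using TC[of v] v by simp
    then show ?thesis using that by (simp add: T_def y_def exp_minus)
  qed
  show ?thesis
  proof (intro exI[of _ y] conjI allI impI)
    show "y 0 = y0" by (simp add: y_def I0)
    fix t :: real assume t: "0 \<le> t"
    show "(y has_vector_derivative F t (y t)) (at t within {0..})"
      using has_vector_derivative_add[OF has_vector_derivative_const I_deriv[OF vc t]] vy[OF t]
      unfolding y_def by simp
  qed
qed

text \<open>Gronwall's argument. It is applied to the squared distance, which is differentiable even
  where the solutions meet and grows at rate at most \<open>2 * L\<close> by Cauchy-Schwarz.\<close>

lemma ivp_continuous_dependence:
  fixes F :: "real \<Rightarrow> 'a::euclidean_space \<Rightarrow> 'a"
  assumes lip: "\<And>t x y. norm (F t x - F t y) \<le> L * norm (x - y)"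
    and y: "\<And>t. 0 \<le> t \<Longrightarrow> (y has_vector_derivative F t (y t)) (at t within {0..})"
    and z: "\<And>t. 0 \<le> t \<Longrightarrow> (z has_vector_derivative F t (z t)) (at t within {0..})"
    and t: "0 \<le> t"
  shows "norm (y t - z t) \<le> exp (L * t) * norm (y 0 - z 0)"
proof -
  define d where "d s = y s - z s" for s
  define e where "e s = F s (y s) - F s (z s)" for s
  have d: "(d has_vector_derivative e s) (at s within {0..})" if "0 \<le> s" for s
    unfolding d_def e_def using y[OF that] z[OF that] by (rule has_vector_derivative_diff)
  define \<phi> where "\<phi> s = exp (- (2 * L * s)) * (d s \<bullet> d s)" for s
  have "\<phi> t \<le> \<phi> 0"
  proof (rule DERIV_nonpos_imp_decreasing_open[OF t])
    fix s assume s: "0 < s" "s < t"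
    have "at s within {0..} = at s" using s by (intro at_within_interior) simp
    then have ds: "(d has_derivative (\<lambda>h. h *\<^sub>R e s)) (at s)"
      using d[of s] s by (simp add: has_vector_derivative_def)
    have "((\<lambda>s. d s \<bullet> d s) has_derivative (\<lambda>h. d s \<bullet> (h *\<^sub>R e s) + (h *\<^sub>R e s) \<bullet> d s)) (at s)"
      by (rule has_derivative_inner[OF ds ds])
    then have "((\<lambda>s. d s \<bullet> d s) has_real_derivative 2 * (d s \<bullet> e s)) (at s)"
      unfolding has_field_derivative_def
      by (rule has_derivative_eq_rhs) (auto simp: fun_eq_iff inner_commute)
    then have der: "(\<phi> has_real_derivative exp (- (2 * L * s)) * (2 * (d s \<bullet> e s) - 2 * L * (d s \<bullet> d s))) (at s)"
      unfolding \<phi>_def by (auto intro!: derivative_eq_intros simp: algebra_simps)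
    have "d s \<bullet> e s \<le> norm (d s) * norm (e s)" by (rule norm_cauchy_schwarz)
    also have "\<dots> \<le> norm (d s) * (L * norm (d s))"
      using lip[of s "y s" "z s"] by (intro mult_left_mono) (auto simp: d_def e_def)
    also have "\<dots> = L * (d s \<bullet> d s)" by (simp add: dot_square_norm power2_eq_square)
    finally show "\<exists>D. (\<phi> has_real_derivative D) (at s) \<and> D \<le> 0"
      using der by (intro exI conjI) (auto simp: mult_le_0_iff)
  next
    have "continuous_on {0..t} d"
      by (rule continuous_on_subset[OF continuous_on_vector_derivative[of "{0..}" d e]]) (use d in auto)
    then show "continuous_on {0..t} \<phi>" unfolding \<phi>_def by (intro continuous_intros)
  qed
  then have "exp (- (2 * L * t)) * (norm (d t))\<^sup>2 \<le> (norm (d 0))\<^sup>2"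
    by (simp add: \<phi>_def dot_square_norm)
  then have "(norm (d t))\<^sup>2 \<le> exp (2 * L * t) * (norm (d 0))\<^sup>2"
    by (simp add: exp_minus field_simps)
  also have "\<dots> = (exp (L * t) * norm (d 0))\<^sup>2"
    by (simp add: power_mult_distrib exp_double[symmetric] mult.assoc)
  finally have "norm (d t) \<le> exp (L * t) * norm (d 0)" by (rule power2_le_imp_le) simp
  then show ?thesis by (simp add: d_def)
qed

text \<open>Since \<open>F\<close> is periodic, \<open>y (t + 1)\<close> solves the same equation
  with the same initial value, so uniqueness gives \<open>y (t + 1) = y t\<close> on the half-line.
  The fractional part extends this to negative times.\<close>

lemma periodic_extension_of_ode_solution:
  fixes F :: "real \<Rightarrow> 'a::euclidean_space \<Rightarrow> 'a"
  assumes lip: "\<And>t x y. norm (F t x - F t y) \<le> L * norm (x - y)"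
    and per: "\<And>t y. F (t + 1) y = F t y"
    and y: "\<And>t. 0 \<le> t \<Longrightarrow> (y has_vector_derivative F t (y t)) (at t within {0..})"
    and y01: "y 1 = y 0"
  shows "\<exists>Y. (\<forall>t. Y (t + 1) = Y t) \<and> (\<forall>t. (Y has_vector_derivative F t (Y t)) (at t))"
proof -
  have y_at: "(y has_vector_derivative F t (y t)) (at t)" if "0 < t" for t
  proof -
    have "at t within {0..} = at t" using that by (intro at_within_interior) simp
    then show ?thesis using y[of t] that by simp
  qed
  have shift: "((\<lambda>s. y (s + c)) has_vector_derivative F (t + c) (y (t + c))) (at t)" if "0 < t + c" for t c
  proof -
    have "((\<lambda>s. s + c) has_vector_derivative 1) (at t)"
      by (auto intro!: derivative_eq_intros)
    from vector_diff_chain_at[OF this y_at[OF that]] show ?thesis by (simp add: o_def)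
  qed
  have step: "y (t + 1) = y t" if "0 \<le> t" for t
  proof -
    have "norm (y (t + 1) - y t) \<le> exp (L * t) * norm (y (0 + 1) - y 0)"
    proof (rule ivp_continuous_dependence[OF lip _ y that, of "\<lambda>t. y (t + 1)"])
      show "((\<lambda>s. y (s + 1)) has_vector_derivative F s (y (s + 1))) (at s within {0..})" if "0 \<le> s" for s
        using shift[of s 1] that per by (simp add: has_vector_derivative_at_within)
    qed
    then show ?thesis by (simp add: y01)
  qed
  have steps: "y (t + real n) = y t" if "0 \<le> t" for t n
  proof (induction n)
    case (Suc n)
    then show ?case using step[of "t + real n"] that by (simp add: algebra_simps)
  qed simp
  have y_frac: "y t = y (frac t)" if "0 \<le> t" for t
    using steps[of "frac t" "nat \<lfloor>t\<rfloor>"] that by (simp add: frac_def)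
  have perF: "F (t + real n) x = F t x" for t x n
  proof (induction n)
    case (Suc n)
    then show ?case using per[of "t + real n"] by (simp add: algebra_simps)
  qed simp
  define Y where "Y t = y (frac t)" for t
  have frac_add: "frac (t + real n) = frac t" for t :: real and n
    by (simp add: frac_def)
  show ?thesis
  proof (intro exI[of _ Y] conjI allI)
    show "Y (t + 1) = Y t" for t using frac_add[of t 1] by (simp add: Y_def)
    fix t :: real
    \<comment> \<open>A shift by \<open>n\<close> carries a neighbourhood of \<open>t\<close> into
      positive times, where \<open>Y\<close> is a translate of \<open>y\<close>; this also covers
      integer \<open>t\<close>, where \<open>frac\<close> jumps.\<close>
    obtain n :: nat where n: "1 - t < real n" using reals_Archimedean2 by blast
    have eq: "y (s + real n) = Y s" if "t - 1 < s" for s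
      using y_frac[of "s + real n"] n that by (simp add: Y_def frac_add)
    have "(Y has_vector_derivative F (t + real n) (y (t + real n))) (at t)"
      by (rule has_vector_derivative_transform_within_open[OF shift[of t "real n"], of "{t-1<..}"])
        (use n eq in auto)
    then show "(Y has_vector_derivative F t (Y t)) (at t)"
      using perF eq[of t] by simp
  qed
qed

text \<open>Since \<open>J\<close> has only the eigenvalues 1 and -1, the unperturbed equation has no periodic
  solution but 0: a suitably preconditioned displacement of the time-one map is bounded, and its
  Brouwer fixed point is the initial value of a periodic solution.\<close>

lemma periodic_solution_exists:
  fixes J :: "'a::euclidean_space \<Rightarrow> 'a" and N :: "real \<Rightarrow> 'a \<Rightarrow> 'a"
  assumes J: "bounded_linear J" and JJ: "\<And>x. J (J x) = x"
    and cont: "continuous_on UNIV (\<lambda>(t, y). N t y)"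
    and lip: "\<And>t x y. norm (N t x - N t y) \<le> L * norm (x - y)"
    and bd: "\<And>t y. norm (N t y) \<le> B"
    and per: "\<And>t y. N (t + 1) y = N t y"
    and L: "0 \<le> L"
  shows "\<exists>y. (\<forall>t. y (t + 1) = y t) \<and> (\<forall>t. (y has_vector_derivative J (y t) + N t (y t)) (at t))"
proof -
  interpret J: bounded_linear J by fact
  obtain K where K: "0 \<le> K" "\<And>x. norm (J x) \<le> norm x * K" using J.nonneg_bounded by blast
  have B: "0 \<le> B" using bd[of 0 0] norm_ge_zero order_trans by blast
  define F where "F t y = J y + N t y" for t y
  have F_cont: "continuous_on UNIV (\<lambda>(t, y). F t y)"
  proof -
    have "continuous_on UNIV (\<lambda>z::real \<times> 'a. J (snd z) + (\<lambda>(t, y). N t y) z)"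
      by (intro continuous_intros cont J.continuous_on)
    then show ?thesis by (simp add: F_def case_prod_unfold)
  qed
  have F_lip: "norm (F t x - F t y) \<le> (K + L) * norm (x - y)" for t x y
  proof -
    have "norm (F t x - F t y) \<le> norm (J (x - y)) + norm (N t x - N t y)"
      using norm_triangle_ineq[of "J (x - y)" "N t x - N t y"] by (simp add: F_def J.diff algebra_simps)
    then show ?thesis using K(2)[of "x - y"] lip[of t x y] by (simp add: algebra_simps)
  qed
  have F_bd: "norm (F t 0) \<le> B" for t using bd by (simp add: F_def J.zero)
  define sol where "sol y0 = (SOME y. y 0 = y0 \<and> (\<forall>t\<ge>0. (y has_vector_derivative F t (y t)) (at t within {0..})))" for y0
  have "sol y0 0 = y0 \<and> (\<forall>t\<ge>0. (sol y0 has_vector_derivative F t (sol y0 t)) (at t within {0..}))" for y0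
    unfolding sol_def
    by (rule someI_ex[OF global_ivp_exists[OF F_cont F_lip F_bd]]) (use K L in auto)
  then have sol0: "sol y0 0 = y0"
    and sol: "\<And>t. 0 \<le> t \<Longrightarrow> (sol y0 has_vector_derivative F t (sol y0 t)) (at t within {0..})" for y0
    by auto
  define C where "C = (1 + K) * B"
  have C: "0 \<le> C" using K B by (simp add: C_def)
  \<comment> \<open>\<open>y + \<sigma> J y\<close> is twice the projection of \<open>y\<close> to
    the eigenspace of \<open>J\<close> for \<open>\<sigma>\<close>. The weight
    \<open>exp (- \<sigma> t)\<close> removes the linear part of the equation, so only
    \<open>N\<close> contributes to the change over one period; \<open>C * exp 1 - C\<close> is the
    integral of \<open>C * exp t\<close>.\<close>
  have bound: "norm (exp (- \<sigma>) *\<^sub>R (sol y0 1 + \<sigma> *\<^sub>R J (sol y0 1)) - (y0 + \<sigma> *\<^sub>R J y0)) \<le> C * exp 1 - C"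
    if \<sigma>: "\<sigma> = 1 \<or> \<sigma> = -1" for \<sigma> y0
  proof -
    define s where "s t = exp (- \<sigma> * t) *\<^sub>R (sol y0 t + \<sigma> *\<^sub>R J (sol y0 t))" for t
    define s' where "s' t = exp (- \<sigma> * t) *\<^sub>R (N t (sol y0 t) + \<sigma> *\<^sub>R J (N t (sol y0 t)))" for t
    have "norm (s 1 - s 0) \<le> C * exp 1 - C * exp 0"
    proof (rule norm_increment_le_on_half_line[where f' = s' and g' = "\<lambda>t. C * exp t"])
      fix t :: real assume t: "0 \<le> t"
      define y where "y = sol y0 t"
      have "((\<lambda>t. J (sol y0 t)) has_vector_derivative J (F t y)) (at t within {0..})"
        using J.has_vector_derivative[OF sol[OF t]] by (simp add: y_def)
      moreover have "((\<lambda>t. exp (- \<sigma> * t)) has_real_derivative - \<sigma> * exp (- \<sigma> * t)) (at t within {0..})"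
        by (auto intro!: derivative_eq_intros)
      ultimately have "(s has_vector_derivative exp (- \<sigma> * t) *\<^sub>R (F t y + \<sigma> *\<^sub>R J (F t y))
          + (- \<sigma> * exp (- \<sigma> * t)) *\<^sub>R (y + \<sigma> *\<^sub>R J y)) (at t within {0..})"
        unfolding s_def using sol[OF t, of y0]
        by (auto intro!: derivative_eq_intros simp: y_def)
      moreover have "exp (- \<sigma> * t) *\<^sub>R (F t y + \<sigma> *\<^sub>R J (F t y))
          + (- \<sigma> * exp (- \<sigma> * t)) *\<^sub>R (y + \<sigma> *\<^sub>R J y) = s' t"
        using \<sigma> by (auto simp: s'_def F_def J.add JJ y_def[symmetric] algebra_simps)
      ultimately show "(s has_vector_derivative s' t) (at t within {0..})" by simp
      have "norm (N t y + \<sigma> *\<^sub>R J (N t y)) \<le> norm (N t y) + norm (J (N t y))"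
        using norm_triangle_ineq[of "N t y" "\<sigma> *\<^sub>R J (N t y)"] \<sigma> by auto
      also have "\<dots> \<le> B + B * K"
        using bd[of t y] K(2)[of "N t y"] mult_right_mono[OF bd[of t y] K(1)] by simp
      finally have "norm (N t y + \<sigma> *\<^sub>R J (N t y)) \<le> C" by (simp add: C_def algebra_simps)
      moreover have "exp (- \<sigma> * t) \<le> exp t" using \<sigma> t by auto
      ultimately have "exp (- \<sigma> * t) * norm (N t y + \<sigma> *\<^sub>R J (N t y)) \<le> exp t * C"
        by (intro mult_mono) auto
      then show "norm (s' t) \<le> C * exp t" by (simp add: s'_def y_def mult.commute)
    qed (auto intro!: derivative_eq_intros)
    then show ?thesis by (simp add: s_def sol0)
  qed
  define e where "e = exp (1::real)"
  have e: "1 < e" by (simp add: e_def)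
  define \<Delta> where "\<Delta> y0 = sol y0 1 - y0" for y0
  \<comment> \<open>On the eigenspace of 1 the displacement \<open>\<Delta> y0\<close> is
    \<open>(e - 1) y0\<close> up to a bounded term, on that of -1 it is
    \<open>- ((e - 1) / e) y0\<close>. The coefficients of \<open>\<Psi>\<close> cancel these linear
    parts exactly, which makes \<open>\<Psi>\<close> bounded; the halves compensate for
    \<open>\<Delta> y0 + J (\<Delta> y0)\<close> being twice a projection.\<close>
  define c d where "c = 1 / (e - 1) / 2" and "d = e / (e - 1) / 2"
  have cd: "c + c = 1 / (e - 1)" "d + d = e / (e - 1)" by (simp_all only: c_def d_def field_sum_of_halves)
  define \<Psi> where "\<Psi> y0 = y0 - c *\<^sub>R (\<Delta> y0 + J (\<Delta> y0))
      + d *\<^sub>R (\<Delta> y0 - J (\<Delta> y0))" for y0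
  have plus: "\<Psi> y0 + J (\<Psi> y0) = (y0 + J y0) - (1 / (e - 1)) *\<^sub>R (\<Delta> y0 + J (\<Delta> y0))" for y0
  proof -
    have "\<Psi> y0 + J (\<Psi> y0) = (y0 + J y0) - (c + c) *\<^sub>R (\<Delta> y0 + J (\<Delta> y0))"
      unfolding \<Psi>_def scaleR_add_left by (simp add: J.add J.diff J.scaleR JJ algebra_simps)
    then show ?thesis by (simp only: cd)
  qed
  have minus: "\<Psi> y0 - J (\<Psi> y0) = (y0 - J y0) + (e / (e - 1)) *\<^sub>R (\<Delta> y0 - J (\<Delta> y0))" for y0
  proof -
    have "\<Psi> y0 - J (\<Psi> y0) = (y0 - J y0) + (d + d) *\<^sub>R (\<Delta> y0 - J (\<Delta> y0))"
      unfolding \<Psi>_def scaleR_add_left by (simp add: J.add J.diff J.scaleR JJ algebra_simps)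
    then show ?thesis by (simp only: cd)
  qed
  have plus_bd: "norm (\<Psi> y0 + J (\<Psi> y0)) \<le> e * C" for y0
  proof -
    have c: "1 + 1 / (e - 1) = e / (e - 1)" using e by (simp add: field_simps)
    have "\<Psi> y0 + J (\<Psi> y0) = (1 + 1 / (e - 1)) *\<^sub>R (y0 + J y0) - (1 / (e - 1)) *\<^sub>R (sol y0 1 + J (sol y0 1))"
      unfolding plus \<Delta>_def by (simp add: J.diff algebra_simps)
    also have "\<dots> = - ((e / (e - 1)) *\<^sub>R (exp (- 1) *\<^sub>R (sol y0 1 + 1 *\<^sub>R J (sol y0 1)) - (y0 + 1 *\<^sub>R J y0)))"
      unfolding c using e by (simp add: scaleR_diff_right exp_minus e_def[symmetric])
    finally have "norm (\<Psi> y0 + J (\<Psi> y0))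
        = e / (e - 1) * norm (exp (- 1) *\<^sub>R (sol y0 1 + 1 *\<^sub>R J (sol y0 1)) - (y0 + 1 *\<^sub>R J y0))"
      using e by simp
    also have "\<dots> \<le> e / (e - 1) * (C * e - C)"
      using bound[of 1 y0] e unfolding e_def[symmetric] by (intro mult_left_mono) auto
    also have "\<dots> = e * C" using e by (simp add: field_simps)
    finally show ?thesis .
  qed
  have minus_bd: "norm (\<Psi> y0 - J (\<Psi> y0)) \<le> C" for y0
  proof -
    have c: "1 - e / (e - 1) = - (1 / (e - 1))" using e by (simp add: field_simps)
    have "\<Psi> y0 - J (\<Psi> y0) = (1 - e / (e - 1)) *\<^sub>R (y0 - J y0) + (e / (e - 1)) *\<^sub>R (sol y0 1 - J (sol y0 1))"
      unfolding minus \<Delta>_def by (simp add: J.diff algebra_simps)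
    also have "\<dots> = (1 / (e - 1)) *\<^sub>R (exp (- (- 1)) *\<^sub>R (sol y0 1 + (- 1) *\<^sub>R J (sol y0 1)) - (y0 + (- 1) *\<^sub>R J y0))"
      unfolding c using e by (simp add: scaleR_diff_right e_def[symmetric])
    finally have "norm (\<Psi> y0 - J (\<Psi> y0))
        = 1 / (e - 1) * norm (exp (- (- 1)) *\<^sub>R (sol y0 1 + (- 1) *\<^sub>R J (sol y0 1)) - (y0 + (- 1) *\<^sub>R J y0))"
      using e by simp
    also have "\<dots> \<le> 1 / (e - 1) * (C * e - C)"
      using bound[of "- 1" y0] e unfolding e_def[symmetric] by (intro mult_left_mono) auto
    also have "\<dots> = C" using e by (simp add: field_simps)
    finally show ?thesis .
  qed
  have \<Psi>_bd: "norm (\<Psi> y0) \<le> e * C + C + 1" for y0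
  proof -
    have "2 *\<^sub>R \<Psi> y0 = (\<Psi> y0 + J (\<Psi> y0)) + (\<Psi> y0 - J (\<Psi> y0))" by (simp add: scaleR_2)
    then have "norm (2 *\<^sub>R \<Psi> y0) \<le> e * C + C"
      by (metis add_mono norm_triangle_le plus_bd minus_bd)
    moreover have "0 \<le> e * C + C" using C e by simp
    ultimately show ?thesis by simp
  qed
  have "continuous_on UNIV (\<lambda>y0. sol y0 1)"
  proof (rule lipschitz_on_continuous_on[OF lipschitz_onI])
    show "dist (sol x 1) (sol y 1) \<le> exp ((K + L) * 1) * dist x y" for x y
      using ivp_continuous_dependence[OF F_lip sol sol, of 1 x y] by (simp add: sol0 dist_norm)
  qed simp
  then have \<Psi>_cont: "continuous_on UNIV \<Psi>"
    unfolding \<Psi>_def \<Delta>_def by (intro continuous_intros J.continuous_on)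
  obtain y0 where y0: "\<Psi> y0 = y0"
  proof (rule brouwer_ball[of "e * C + C + 1" 0 \<Psi>])
    show "0 < e * C + C + 1" using C e by (simp add: add_nonneg_pos)
    show "continuous_on (cball 0 (e * C + C + 1)) \<Psi>" using \<Psi>_cont continuous_on_subset by blast
  qed (use \<Psi>_bd in auto)
  \<comment> \<open>At a fixed point of \<open>\<Psi>\<close> both spectral parts of the
    displacement vanish, so the solution returns to its initial value.\<close>
  have "\<Delta> y0 + J (\<Delta> y0) = 0" using plus[of y0] y0 e by simp
  moreover have "\<Delta> y0 - J (\<Delta> y0) = 0" using minus[of y0] y0 e by simp
  ultimately have "2 *\<^sub>R \<Delta> y0 = 0" by (simp add: scaleR_2)
  then have "sol y0 1 = sol y0 0" by (simp add: \<Delta>_def sol0)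
  from periodic_extension_of_ode_solution[OF F_lip _ sol this] show ?thesis
    by (simp add: F_def per)
qed

subsection \<open>Lipschitz functions, monotone equations and periodic functions\<close>

definition bounded_lipschitz :: "('a::metric_space \<Rightarrow> real) \<Rightarrow> bool" where
  "bounded_lipschitz f \<longleftrightarrow> (\<exists>B L. \<forall>x y. \<bar>f x\<bar> \<le> B \<and> \<bar>f x - f y\<bar> \<le> L * dist x y)"

lemma bounded_lipschitzE:
  assumes "bounded_lipschitz f"
  obtains B L where "0 \<le> B" "0 \<le> L" "\<And>x. \<bar>f x\<bar> \<le> B" "\<And>x y. \<bar>f x - f y\<bar> \<le> L * dist x y"
proof -
  from assms obtain B L where BL: "\<And>x y. \<bar>f x\<bar> \<le> B \<and> \<bar>f x - f y\<bar> \<le> L * dist x y"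
    unfolding bounded_lipschitz_def by blast
  show ?thesis
  proof (rule that[of "\<bar>B\<bar>" "\<bar>L\<bar>"])
    show "\<bar>f x\<bar> \<le> \<bar>B\<bar>" for x using BL[of x x] by linarith
    have "L * dist x y \<le> \<bar>L\<bar> * dist x y" for x y :: 'a by (intro mult_right_mono) auto
    then show "\<bar>f x - f y\<bar> \<le> \<bar>L\<bar> * dist x y" for x y using BL[of x y] order_trans by blast
  qed auto
qed

lemma bounded_lipschitz_diff:
  assumes "bounded_lipschitz f" "bounded_lipschitz g"
  shows "bounded_lipschitz (\<lambda>x. f x - g x)"
proof -
  obtain B L where f: "0 \<le> B" "0 \<le> L" "\<And>x. \<bar>f x\<bar> \<le> B" "\<And>x y. \<bar>f x - f y\<bar> \<le> L * dist x y"
    by (rule bounded_lipschitzE[OF assms(1)]) (rule that)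
  obtain B' L' where g: "0 \<le> B'" "0 \<le> L'" "\<And>x. \<bar>g x\<bar> \<le> B'" "\<And>x y. \<bar>g x - g y\<bar> \<le> L' * dist x y"
    by (rule bounded_lipschitzE[OF assms(2)]) (rule that)
  show ?thesis
    unfolding bounded_lipschitz_def
  proof (rule exI[of _ "B + B'"], rule exI[of _ "L + L'"], intro allI conjI)
    fix x y
    show "\<bar>f x - g x\<bar> \<le> B + B'" using f(3)[of x] g(3)[of x] by linarith
    show "\<bar>f x - g x - (f y - g y)\<bar> \<le> (L + L') * dist x y"
      unfolding distrib_right using f(4)[of x y] g(4)[of x y] by linarith
  qed
qed

lemma bounded_lipschitz_mult:
  assumes "bounded_lipschitz f" "bounded_lipschitz g"
  shows "bounded_lipschitz (\<lambda>x. f x * g x)"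
proof -
  obtain B L where f: "0 \<le> B" "0 \<le> L" "\<And>x. \<bar>f x\<bar> \<le> B" "\<And>x y. \<bar>f x - f y\<bar> \<le> L * dist x y"
    by (rule bounded_lipschitzE[OF assms(1)]) (rule that)
  obtain B' L' where g: "0 \<le> B'" "0 \<le> L'" "\<And>x. \<bar>g x\<bar> \<le> B'" "\<And>x y. \<bar>g x - g y\<bar> \<le> L' * dist x y"
    by (rule bounded_lipschitzE[OF assms(2)]) (rule that)
  show ?thesis
    unfolding bounded_lipschitz_def
  proof (rule exI[of _ "B * B'"], rule exI[of _ "L * B' + B * L'"], intro allI conjI)
    fix x y
    show "\<bar>f x * g x\<bar> \<le> B * B'"
      unfolding abs_mult using f g by (intro mult_mono) auto
    have "\<bar>f x * g x - f y * g y\<bar> = \<bar>(f x - f y) * g x + f y * (g x - g y)\<bar>"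
      by (simp add: algebra_simps)
    also have "\<dots> \<le> \<bar>f x - f y\<bar> * \<bar>g x\<bar> + \<bar>f y\<bar> * \<bar>g x - g y\<bar>"
      by (rule order_trans[OF abs_triangle_ineq]) (simp add: abs_mult)
    also have "\<dots> \<le> (L * dist x y) * B' + B * (L' * dist x y)"
      using f g by (intro add_mono mult_mono) auto
    finally show "\<bar>f x * g x - f y * g y\<bar> \<le> (L * B' + B * L') * dist x y"
      by (simp add: algebra_simps)
  qed
qed

lemma bounded_lipschitz_compose:
  assumes "bounded_lipschitz g" and q: "\<And>x y. \<bar>q x - q y\<bar> \<le> K * dist x y"
  shows "bounded_lipschitz (\<lambda>x. g (q x))"
proof -
  obtain B L where g: "0 \<le> B" "0 \<le> L" "\<And>x. \<bar>g x\<bar> \<le> B" "\<And>x y. \<bar>g x - g y\<bar> \<le> L * dist x y"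
    by (rule bounded_lipschitzE[OF assms(1)]) (rule that)
  show ?thesis
    unfolding bounded_lipschitz_def
  proof (rule exI[of _ B], rule exI[of _ "L * K"], intro allI conjI)
    fix x y
    show "\<bar>g (q x)\<bar> \<le> B" by (rule g)
    have "\<bar>g (q x) - g (q y)\<bar> \<le> L * \<bar>q x - q y\<bar>" using g(4) by (simp add: dist_real_def)
    also have "\<dots> \<le> L * (K * dist x y)" using q g(2) by (rule mult_left_mono)
    finally show "\<bar>g (q x) - g (q y)\<bar> \<le> L * K * dist x y" by (simp add: mult.assoc)
  qed
qed

lemma bounded_lipschitz_continuous:
  assumes "bounded_lipschitz f"
  shows "continuous_on S f"
proof -
  obtain B L where f: "0 \<le> B" "0 \<le> L" "\<And>x. \<bar>f x\<bar> \<le> B" "\<And>x y. \<bar>f x - f y\<bar> \<le> L * dist x y"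
    by (rule bounded_lipschitzE[OF assms]) (rule that)
  show ?thesis
    by (rule lipschitz_on_continuous_on[OF lipschitz_onI[of S f L]]) (use f in \<open>auto simp: dist_real_def\<close>)
qed

text \<open>Clamping is 1-Lipschitz with values in a compact interval, on which \<open>g\<close> and
  its continuous derivative are bounded.\<close>

lemma bounded_lipschitz_clamp:
  fixes g :: "real \<Rightarrow> real"
  assumes lr: "l \<le> r"
    and g: "\<And>x. l \<le> x \<Longrightarrow> x \<le> r \<Longrightarrow> (g has_real_derivative g' x) (at x)"
    and g': "continuous_on {l..r} g'"
  shows "bounded_lipschitz (\<lambda>x. g (max l (min r x)))"
proof -
  have "continuous_on {l..r} g"
    by (rule DERIV_continuous_on[where D = g']) (use g in \<open>auto intro: has_field_derivative_at_within\<close>)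
  then have "bounded (g ` {l..r})" by (intro compact_imp_bounded compact_continuous_image) auto
  then obtain B where B: "\<forall>x\<in>{l..r}. \<bar>g x\<bar> \<le> B" by (auto simp: bounded_iff)
  have "bounded (g' ` {l..r})" using g' by (intro compact_imp_bounded compact_continuous_image) auto
  then obtain L where L: "\<forall>x\<in>{l..r}. \<bar>g' x\<bar> \<le> L" by (auto simp: bounded_iff)
  have L0: "0 \<le> L" using bspec[OF L, of l] lr by auto
  show ?thesis
    unfolding bounded_lipschitz_def
  proof (rule exI[of _ B], rule exI[of _ L], intro allI conjI)
    fix x y :: real
    define x' y' where "x' = max l (min r x)" and "y' = max l (min r y)"
    have in_lr: "x' \<in> {l..r}" "y' \<in> {l..r}" using lr by (auto simp: x'_def y'_def)
    show "\<bar>g (max l (min r x))\<bar> \<le> B" using bspec[OF B in_lr(1)] by (simp add: x'_def)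
    have "\<bar>g x' - g y'\<bar> \<le> L * \<bar>x' - y'\<bar>"
      using field_differentiable_bound[of "{l..r}" g g' L x' y'] in_lr L g
      by (auto intro: has_field_derivative_at_within)
    also have "\<dots> \<le> L * \<bar>x - y\<bar>" using L0 by (intro mult_left_mono) (auto simp: x'_def y'_def)
    finally show "\<bar>g (max l (min r x)) - g (max l (min r y))\<bar> \<le> L * dist x y"
      by (simp add: x'_def y'_def dist_real_def)
  qed
qed

section \<open>Scalar equations with a monotone term\<close>

lemma monotone_equation_solvable:
  fixes h :: "real \<Rightarrow> real"
  assumes k: "1 \<le> k" and c: "0 \<le> c" and h: "continuous_on UNIV h" "\<And>p. \<bar>h p\<bar> \<le> B"
  shows "\<exists>p. k * p + c * h p = s"
proof -
  \<comment> \<open>At \<open>p = X\<close> and \<open>p = - X\<close> the linear term has size at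
    least \<open>\<bar>s\<bar> + c * B\<close>, which the term \<open>c * h p\<close> cannot
    outweigh; the intermediate value theorem applies in between.\<close>
  define X where "X = \<bar>s\<bar> + c * B"
  have B: "0 \<le> B" using h(2)[of 0] by linarith
  have X: "0 \<le> X" using c B by (simp add: X_def)
  have kX: "X \<le> k * X" using k X by (simp add: mult_le_cancel_right1)
  have ch: "\<bar>c * h p\<bar> \<le> c * B" for p
    unfolding abs_mult using c h(2)[of p] by (intro mult_mono) auto
  have "\<exists>p. -X \<le> p \<and> p \<le> X \<and> k * p + c * h p = s"
  proof (rule IVT')
    have "- (k * X) + c * h (-X) \<le> s" using kX ch[of "-X"] X_def by linarith
    then show "k * (-X) + c * h (-X) \<le> s" by simp
    show "s \<le> k * X + c * h X" using kX ch[of X] X_def by linarith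
    show "continuous_on {-X..X} (\<lambda>p. k * p + c * h p)"
      by (intro continuous_intros continuous_on_subset[OF h(1)]) auto
  qed (use X in auto)
  then show ?thesis by blast
qed

text \<open>Subtracting the equations leaves \<open>k * (p - q)\<close> and
  \<open>c * (h p - h q)\<close> on one side. They have the same sign because \<open>h\<close> is
  nondecreasing, so neither can cancel the other.\<close>

lemma monotone_equation_solution_lipschitz:
  fixes h :: "real \<Rightarrow> real"
  assumes k: "1 \<le> k" and c: "0 \<le> c" and mono: "\<And>p q. p \<le> q \<Longrightarrow> h p \<le> h q"
    and p: "k * p + c * h p = s" and q: "k * q + d * h q = t"
  shows "\<bar>p - q\<bar> \<le> \<bar>s - t\<bar> + \<bar>c - d\<bar> * \<bar>h q\<bar>"
proof -
  have eq: "k * (p - q) + c * (h p - h q) = (s - t) - (c - d) * h q"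
    using p q by (simp add: algebra_simps)
  have "0 \<le> (p - q) * (h p - h q)"
    using mono[of p q] mono[of q p] by (cases "p \<le> q") (auto simp: zero_le_mult_iff)
  then have "\<bar>p - q\<bar> \<le> \<bar>k * (p - q) + c * (h p - h q)\<bar>"
  proof -
    have 1: "\<bar>p - q\<bar> \<le> \<bar>k * (p - q)\<bar>" using k by (simp add: abs_mult mult_le_cancel_right1)
    have "0 \<le> (k * (p - q)) * (c * (h p - h q))"
      using k c \<open>0 \<le> (p - q) * (h p - h q)\<close>
      by (metis mult.assoc mult.left_commute mult_nonneg_nonneg order_trans zero_le_one)
    then have "\<bar>k * (p - q)\<bar> \<le> \<bar>k * (p - q) + c * (h p - h q)\<bar>"
      by (auto simp: zero_le_mult_iff)
    then show ?thesis using 1 by linarith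
  qed
  also have "\<dots> \<le> \<bar>s - t\<bar> + \<bar>c - d\<bar> * \<bar>h q\<bar>"
    unfolding eq using abs_triangle_ineq4[of "s - t" "(c - d) * h q"] by (simp add: abs_mult)
  finally show ?thesis .
qed

text \<open>Implicit differentiation by Caratheodory's slope functions. Continuity of
  \<open>p\<close> comes from the Lipschitz estimate above, and monotonicity makes the slope
  \<open>G\<close> of \<open>h\<close> nonnegative, so the denominator stays at least
  \<open>k\<close>.\<close>

lemma monotone_equation_solution_has_derivative:
  fixes h :: "real \<Rightarrow> real"
  assumes k: "1 \<le> k" and c: "\<And>y. 0 \<le> c y" and mono: "\<And>p q. p \<le> q \<Longrightarrow> h p \<le> h q"
    and eq: "\<And>y. k * p y + c y * h (p y) = s y"
    and s: "(s has_real_derivative s') (at x)" and cd: "(c has_real_derivative c') (at x)"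
    and h: "(h has_real_derivative h') (at (p x))"
  shows "0 \<le> h'" "(p has_real_derivative (s' - c' * h (p x)) / (k + c x * h')) (at x)"
proof -
  have p_cont: "isCont p x"
  proof -
    have "((\<lambda>y. \<bar>s y - s x\<bar> + \<bar>c y - c x\<bar> * \<bar>h (p x)\<bar>) \<longlongrightarrow> \<bar>s x - s x\<bar> + \<bar>c x - c x\<bar> * \<bar>h (p x)\<bar>) (at x)"
      using DERIV_isCont[OF s] DERIV_isCont[OF cd] unfolding isCont_def by (intro tendsto_intros)
    then have "((\<lambda>y. \<bar>s y - s x\<bar> + \<bar>c y - c x\<bar> * \<bar>h (p x)\<bar>) \<longlongrightarrow> 0) (at x)" by simp
    moreover have "\<forall>\<^sub>F y in at x. norm (p y - p x) \<le> \<bar>s y - s x\<bar> + \<bar>c y - c x\<bar> * \<bar>h (p x)\<bar>"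
      using monotone_equation_solution_lipschitz[where h = h, OF k c mono eq eq[of x]] by (intro always_eventually) auto
    ultimately have "((\<lambda>y. p y - p x) \<longlongrightarrow> 0) (at x)" by (rule Lim_null_comparison[rotated])
    then show ?thesis unfolding isCont_def by (rule LIM_zero_cancel)
  qed
  obtain G where G: "\<And>q. h q - h (p x) = G q * (q - p x)" "isCont G (p x)" "G (p x) = h'"
    using h unfolding CARAT_DERIV by auto
  obtain S where S: "\<And>y. s y - s x = S y * (y - x)" "isCont S x" "S x = s'"
    using s unfolding CARAT_DERIV by auto
  obtain D where D: "\<And>y. c y - c x = D y * (y - x)" "isCont D x" "D x = c'"
    using cd unfolding CARAT_DERIV by auto
  have G0: "0 \<le> G q" if "q \<noteq> p x" for q
    using G(1)[of q] mono[of q "p x"] mono[of "p x" q] that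
    by (smt (verit) mult_nonneg_nonneg mult_pos_neg mult_neg_neg mult_neg_pos)
  show h': "0 \<le> h'"
  proof -
    have "(G \<longlongrightarrow> h') (at (p x))" using G by (simp add: isCont_def)
    moreover have "\<forall>\<^sub>F q in at (p x). 0 \<le> G q" using G0 by (simp add: eventually_at_filter)
    ultimately show ?thesis by (rule tendsto_lowerbound) simp
  qed
  have Gp: "0 \<le> G (p y)" for y using G0[of "p y"] G(3) h' by (cases "p y = p x") auto
  have pos: "0 < k + c y * G (p y)" for y
    using k c[of y] Gp[of y] by (simp add: add_pos_nonneg)
  show "(p has_real_derivative (s' - c' * h (p x)) / (k + c x * h')) (at x)"
    unfolding CARAT_DERIV
  \<comment> \<open>The slope of \<open>p\<close> is found by subtracting the equations at
    \<open>y\<close> and \<open>x\<close> and solving for \<open>p y - p x\<close>.\<close>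
  proof (intro exI[of _ "\<lambda>y. (S y - D y * h (p x)) / (k + c y * G (p y))"] conjI allI)
    fix y
    have "(k + c y * G (p y)) * (p y - p x) = k * (p y - p x) + c y * (h (p y) - h (p x))"
      unfolding G(1)[of "p y"] by (simp add: algebra_simps)
    also have "\<dots> = (s y - s x) - (c y - c x) * h (p x)"
      using eq[of y] eq[of x] by (simp add: algebra_simps)
    also have "\<dots> = (S y - D y * h (p x)) * (y - x)"
      unfolding S(1)[of y] D(1)[of y] by (simp add: algebra_simps)
    finally show "p y - p x = (S y - D y * h (p x)) / (k + c y * G (p y)) * (y - x)"
      using pos[of y] by (simp add: field_simps)
    have "isCont (\<lambda>y. G (p y)) x" using isCont_o2[OF p_cont G(2)] .
    then show "isCont (\<lambda>y. (S y - D y * h (p x)) / (k + c y * G (p y))) x"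
      using S(2) D(2) DERIV_isCont[OF cd] pos[of x] by (intro continuous_intros) auto
  qed (simp add: S D G)
qed

section \<open>Minima and bounds of periodic functions\<close>

lemma second_derivative_nonneg_at_minimum:
  fixes f :: "real \<Rightarrow> real"
  assumes f: "\<And>x. (f has_real_derivative f' x) (at x)"
    and f': "(f' has_real_derivative D) (at x)"
    and min: "\<And>y. f x \<le> f y"
  shows "f' x = 0" "0 \<le> D"
proof -
  show f0: "f' x = 0" by (rule DERIV_local_min[OF f, of 1]) (use min in auto)
  show "0 \<le> D"
  proof (rule ccontr)
    assume "\<not> 0 \<le> D"
    then obtain d where d: "d > 0" "\<And>h. 0 < h \<Longrightarrow> h < d \<Longrightarrow> f' (x + h) < f' x"
      using DERIV_neg_dec_right[OF f'] by auto
    obtain z where z: "x < z" "z < x + d / 2" "f (x + d / 2) - f x = (x + d / 2 - x) * f' z"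
      using MVT2[of x "x + d / 2" f f'] f d(1) by auto
    have "f' z < 0" using d(2)[of "z - x"] z f0 d(1) by auto
    then have "(d / 2) * f' z < 0" using d(1) by (simp add: mult_pos_neg)
    then show False using z(3) min[of "x + d / 2"] by simp
  qed
qed

lemma periodic1_frac:
  assumes "periodic1 f"
  shows "f x = f (frac x)"
proof -
  have n: "f (x + real n) = f x" for x n
  proof (induction n)
    case (Suc n)
    then show ?case using assms[unfolded periodic1_def, rule_format, of "x + real n"] by (simp add: algebra_simps)
  qed simp
  show ?thesis
  proof (cases "0 \<le> \<lfloor>x\<rfloor>")
    case True
    then show ?thesis using n[of "frac x" "nat \<lfloor>x\<rfloor>"] by (simp add: frac_def)
  next
    case False
    then show ?thesis using n[of x "nat (- \<lfloor>x\<rfloor>)"] by (simp add: frac_def)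
  qed
qed

lemma frac_in_unit: "0 \<le> frac x" "frac x \<le> (1::real)"
  using frac_lt_1[of x] by auto

lemma periodic1_attains_minimum:
  assumes "periodic1 f" "continuous_on UNIV f"
  obtains x where "\<And>y. f x \<le> f y"
proof -
  obtain x where x: "\<forall>y\<in>{0..1}. f x \<le> f y"
    using continuous_attains_inf[of "{0..1::real}" f] continuous_on_subset[OF assms(2)] by auto
  have "f x \<le> f y" for y
    using x periodic1_frac[OF assms(1), of y] frac_in_unit[of y] by simp
  then show ?thesis by (rule that)
qed

lemma periodic1_bounded:
  assumes "periodic1 f" "continuous_on UNIV f"
  obtains B where "0 \<le> B" "\<And>x. \<bar>f x\<bar> \<le> B"
proof -
  have "bounded (f ` {0..1})"
    using continuous_on_subset[OF assms(2)] by (intro compact_imp_bounded compact_continuous_image) auto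
  then obtain B where B: "\<forall>x\<in>{0..1}. \<bar>f x\<bar> \<le> B" by (auto simp: bounded_iff)
  show ?thesis
  proof (rule that[of B])
    show "0 \<le> B" using bspec[OF B, of 0] by auto
    show "\<bar>f x\<bar> \<le> B" for x
      using bspec[OF B, of "frac x"] periodic1_frac[OF assms(1), of x] frac_in_unit[of x] by simp
  qed
qed

text \<open>An \<open>L\<^sup>1\<close> bound on the source bounds a periodic solution uniformly,
  since \<open>exp (- \<sigma> x) * s x\<close> changes only through \<open>\<phi>\<close>. The
  \<open>L\<^sup>1\<close> bound is encoded by the increment of an antiderivative
  \<open>\<Psi>\<close> of a majorant, so no integral of \<open>\<phi>\<close> occurs.\<close>

lemma periodic_linear_ode_bound:
  fixes s :: "real \<Rightarrow> real"
  assumes \<sigma>: "\<sigma> = 1 \<or> \<sigma> = -1"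
    and s: "\<And>x. (s has_real_derivative \<sigma> * s x + \<phi> x) (at x)"
    and \<Psi>: "\<And>x. (\<Psi> has_real_derivative \<Psi>' x) (at x)"
    and le: "\<And>x. \<bar>\<phi> x\<bar> \<le> \<Psi>' x"
    and s01: "s 1 = s 0" and C: "\<Psi> 1 - \<Psi> 0 = C" and x: "0 \<le> x" "x \<le> 1"
  shows "\<bar>s x\<bar> \<le> 27 * C"
proof -
  have \<Psi>'0: "0 \<le> \<Psi>' t" for t using le[of t] by linarith
  have \<Psi>mono: "\<Psi> t \<le> \<Psi> t'" if "t \<le> t'" for t t'
    by (rule DERIV_nonneg_imp_nondecreasing[OF that]) (use \<Psi> \<Psi>'0 in blast)
  have C0: "0 \<le> C" using \<Psi>mono[of 0 1] C by simp
  have exp3: "exp (1::real) \<le> 3" by (rule exp_le)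
  have exp2: "(2::real) \<le> exp 1" using exp_ge_add_one_self[of 1] by simp
  have est: "\<bar>exp (- \<sigma> * t) * s t - s 0\<bar> \<le> 3 * C" if t: "0 \<le> t" "t \<le> 1" for t
  proof (cases "t = 0")
    case False
    then have "0 < t" using t by simp
    then have "norm ((\<lambda>t. exp (- \<sigma> * t) * s t) t - (\<lambda>t. exp (- \<sigma> * t) * s t) 0) \<le> 3 * \<Psi> t - 3 * \<Psi> 0"
    proof (rule differentiable_bound_general[where f' = "\<lambda>t. exp (- \<sigma> * t) * \<phi> t" and \<phi>' = "\<lambda>t. 3 * \<Psi>' t"])
      show der: "((\<lambda>t. exp (- \<sigma> * t) * s t) has_vector_derivative exp (- \<sigma> * y) * \<phi> y) (at y)" for y
        unfolding has_real_derivative_iff_has_vector_derivative[symmetric]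
        by (auto intro!: derivative_eq_intros s simp: algebra_simps)
      show der': "((\<lambda>t. 3 * \<Psi> t) has_vector_derivative 3 * \<Psi>' y) (at y)" for y
        unfolding has_real_derivative_iff_has_vector_derivative[symmetric]
        by (auto intro!: derivative_eq_intros \<Psi>)
      show "continuous_on {0..t} (\<lambda>t. exp (- \<sigma> * t) * s t)"
        using der by (intro continuous_on_vector_derivative) (rule has_vector_derivative_at_within)
      show "continuous_on {0..t} (\<lambda>t. 3 * \<Psi> t)"
        using der' by (intro continuous_on_vector_derivative) (rule has_vector_derivative_at_within)
      fix y assume y: "0 < y" "y < t"
      have "exp (- \<sigma> * y) \<le> exp 1" using \<sigma> y t by auto
      then have "exp (- \<sigma> * y) \<le> 3" using exp3 by linarith
      then have "exp (- \<sigma> * y) * \<bar>\<phi> y\<bar> \<le> 3 * \<Psi>' y"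
        using le[of y] by (rule mult_mono) auto
      then show "norm (exp (- \<sigma> * y) * \<phi> y) \<le> 3 * \<Psi>' y" by (simp add: abs_mult)
    qed
    then show ?thesis using \<Psi>mono[of t 1] t C by auto
  qed (use C0 in auto)
  \<comment> \<open>Over a full period the weighted increment is
    \<open>(exp (- \<sigma>) - 1) * s 0\<close>, and the factor has absolute value at least 1/2 for
    both signs.\<close>
  have s0: "\<bar>s 0\<bar> \<le> 6 * C"
  proof (cases "\<sigma> = 1")
    case True
    have "exp (-1::real) \<le> 1/2" using exp2 by (simp add: exp_minus field_simps)
    then have "1/2 * \<bar>s 0\<bar> \<le> (1 - exp (-1)) * \<bar>s 0\<bar>" by (intro mult_right_mono) auto
    also have "\<dots> = \<bar>exp (-1) * s 0 - s 0\<bar>"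
    proof -
      have "exp (-1) * s 0 - s 0 = - ((1 - exp (-1)) * s 0)" by (simp add: algebra_simps)
      then show ?thesis by (simp add: abs_mult)
    qed
    finally have "1/2 * \<bar>s 0\<bar> \<le> \<bar>exp (-1) * s 0 - s 0\<bar>" .
    moreover have "\<bar>exp (-1) * s 0 - s 0\<bar> \<le> 3 * C" using est[of 1] True s01 by simp
    ultimately show ?thesis by linarith
  next
    case False
    have "1 * \<bar>s 0\<bar> \<le> (exp 1 - 1) * \<bar>s 0\<bar>" using exp2 by (intro mult_right_mono) auto
    also have "\<dots> = \<bar>exp 1 * s 0 - s 0\<bar>"
    proof -
      have "exp 1 * s 0 - s 0 = (exp 1 - 1) * s 0" by (simp add: algebra_simps)
      then show ?thesis using exp2 by (simp add: abs_mult)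
    qed
    finally have "\<bar>s 0\<bar> \<le> \<bar>exp 1 * s 0 - s 0\<bar>" by simp
    moreover have "\<bar>exp 1 * s 0 - s 0\<bar> \<le> 3 * C" using est[of 1] False \<sigma> s01 by simp
    ultimately show ?thesis using C0 by linarith
  qed
  \<comment> \<open>Removing the weight costs another factor 3, which gives 3 * (3 + 6) =
    27.\<close>
  have "exp (\<sigma> * x) \<le> exp 1" using \<sigma> x by auto
  then have ex3: "exp (\<sigma> * x) \<le> 3" using exp3 by linarith
  have "\<bar>exp (- \<sigma> * x) * s x\<bar> \<le> 9 * C" using est[OF x] s0 by linarith
  then have "exp (\<sigma> * x) * \<bar>exp (- \<sigma> * x) * s x\<bar> \<le> 3 * (9 * C)"
    by (rule mult_mono[OF ex3]) auto
  moreover have "exp (\<sigma> * x) * \<bar>exp (- \<sigma> * x) * s x\<bar> = \<bar>s x\<bar>"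
    by (simp add: abs_mult exp_minus)
  ultimately show ?thesis by simp
qed

subsection \<open>The truncated system\<close>

text \<open>\<open>H1\<close> and \<open>H2\<close> name the first two derivatives of
  \<open>H\<close>. The right-hand side of \<open>H_legendre\<close> is the convex conjugate of
  \<open>H\<close> at \<open>H1 p\<close>; its linear growth is what controls \<open>g\<close>. By
  \<open>H1_sign\<close> the derivative has the sign of its argument outside the interval from
  \<open>- p0\<close> to \<open>p0\<close>, so that truncating \<open>p\<close> at a level of at
  least \<open>p0\<close> preserves signs.\<close>

locale mfg_data =
  fixes H H1 H2 V :: "real \<Rightarrow> real" and \<alpha> c0 c1 p0 v0 :: real
  assumes H_deriv: "\<And>p. (H has_real_derivative H1 p) (at p)"
    and H1_deriv: "\<And>p. (H1 has_real_derivative H2 p) (at p)"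
    and H2_cont: "continuous_on UNIV H2"
    and H1_mono: "\<And>p q. p \<le> q \<Longrightarrow> H1 p \<le> H1 q"
    and H_lower: "\<And>p. - c1 \<le> H p" and c1: "0 \<le> c1"
    and H_legendre: "\<And>p. \<bar>H1 p\<bar> - c0 \<le> p * H1 p - H p" and c0: "0 \<le> c0"
    and H1_sign: "\<And>p. p0 \<le> p \<Longrightarrow> 0 \<le> H1 p" "\<And>p. p \<le> - p0 \<Longrightarrow> H1 p \<le> 0" and p0: "0 \<le> p0"
    and V_periodic: "periodic1 V" and V_cont: "continuous_on UNIV V"
    and V_bound: "\<And>x. \<bar>V x\<bar> \<le> v0"
    and \<alpha>: "0 < \<alpha>"

text \<open>In the unknowns \<open>a = u - \<epsilon> m\<close> and \<open>b = m + \<epsilon> u\<close> the two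
  equations of the system become \<open>a - a'' = f\<close> and \<open>(b' + g)' = b - 1\<close>; \<open>p\<close> stands
  for \<open>u'\<close>, and \<open>H\<close>, \<open>m\<close> are truncated inside the nonlinearities. The factor
  \<open>M / max M m\<close> in \<open>f\<close> matches the cut-off of \<open>m\<close> in \<open>g\<close>, which keeps the
  energy identity usable.\<close>

locale truncated_mfg = mfg_data +
  fixes \<epsilon> \<delta> M R :: real and a w b z p m f g :: "real \<Rightarrow> real"
  assumes a_deriv: "\<And>x. (a has_real_derivative w x) (at x)"
    and w_deriv: "\<And>x. (w has_real_derivative a x - f x) (at x)"
    and b_deriv: "\<And>x. (b has_real_derivative z x - g x) (at x)"
    and z_deriv: "\<And>x. (z has_real_derivative b x - 1) (at x)"
    and periodic: "periodic1 a" "periodic1 w" "periodic1 b" "periodic1 z" "periodic1 p"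
    and m_eq: "\<And>x. m x = (b x - \<epsilon> * a x) / (1 + \<epsilon>\<^sup>2)"
    and p_eq: "\<And>x. (1 + \<epsilon>\<^sup>2) * p x + \<epsilon> * g x = w x + \<epsilon> * z x"
    and f_eq: "\<And>x. f x = max \<delta> (min M (m x)) powr \<alpha> - M / max M (m x) * H (max (-R) (min R (p x))) - V x"
    and g_eq: "\<And>x. g x = max 0 (min M (m x)) * H1 (max (-R) (min R (p x)))"

text \<open>Solving the monotone equation makes \<open>p\<close> a Lipschitz function of the state
  \<open>(a, w, b, z)\<close>, so \<open>f\<close> (apart from \<open>V\<close>) and
  \<open>g\<close> become bounded Lipschitz functions of the state and
  \<open>periodic_solution_exists\<close> applies.\<close>

lemma (in mfg_data) truncated_mfg_solvable:
  assumes \<epsilon>: "0 < \<epsilon>" and \<delta>: "0 < \<delta>" "\<delta> \<le> M" and R: "0 \<le> R"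
  shows "\<exists>a w b z p m f g. truncated_mfg H H1 H2 V \<alpha> c0 c1 p0 v0 \<epsilon> \<delta> M R a w b z p m f g"
proof -
  have M: "0 < M" using \<delta> by simp
  define h where "h q = H1 (max (-R) (min R q))" for q
  have h_bl: "bounded_lipschitz h"
    unfolding h_def by (rule bounded_lipschitz_clamp[OF _ H1_deriv]) (use R H2_cont continuous_on_subset in auto)
  have H1_cont: "continuous_on S H1" for S
    using H1_deriv by (intro DERIV_continuous_on) (rule has_field_derivative_at_within)
  have Ht_bl: "bounded_lipschitz (\<lambda>q. H (max (-R) (min R q)))"
    by (rule bounded_lipschitz_clamp[OF _ H_deriv]) (use R H1_cont in auto)
  have powr_bl: "bounded_lipschitz (\<lambda>q. max \<delta> (min M q) powr \<alpha>)"
    by (rule bounded_lipschitz_clamp[OF \<delta>(2), where g = "\<lambda>q. q powr \<alpha>" and g' = "\<lambda>q. \<alpha> * q powr (\<alpha> - 1)"])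
      (use \<delta> in \<open>auto intro!: derivative_eq_intros continuous_intros\<close>)
  have cap_bl: "bounded_lipschitz (\<lambda>q. max 0 (min M q))"
    by (rule bounded_lipschitz_clamp[where g = "\<lambda>q. q" and g' = "\<lambda>q. 1"])
      (use M in \<open>auto intro!: derivative_eq_intros\<close>)
  have quot_bl: "bounded_lipschitz (\<lambda>q. M / max M q)"
    unfolding bounded_lipschitz_def
  proof (rule exI[of _ 1], rule exI[of _ "1 / M"], intro allI conjI)
    fix x y :: real
    show "\<bar>M / max M x\<bar> \<le> 1" using M by (simp add: divide_le_eq)
    have "M / max M x - M / max M y = M * (max M y - max M x) / (max M x * max M y)"
      using M by (simp add: field_simps)
    then have "\<bar>M / max M x - M / max M y\<bar> = M * \<bar>max M y - max M x\<bar> / (max M x * max M y)"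
      using M by (simp add: abs_mult)
    also have "\<dots> \<le> M * \<bar>x - y\<bar> / (M * M)"
      using M by (intro frac_le mult_mono mult_nonneg_nonneg) auto
    finally show "\<bar>M / max M x - M / max M y\<bar> \<le> 1 / M * dist x y"
      using M by (simp add: dist_real_def field_simps)
  qed
  obtain Bh Lh where h: "0 \<le> Bh" "0 \<le> Lh" "\<And>q. \<bar>h q\<bar> \<le> Bh" "\<And>x y. \<bar>h x - h y\<bar> \<le> Lh * dist x y"
    by (rule bounded_lipschitzE[OF h_bl]) (rule that)
  define k where "k = 1 + \<epsilon>\<^sup>2"
  have k: "1 \<le> k" by (simp add: k_def)
  define A W B Z :: "real \<times> real \<times> real \<times> real \<Rightarrow> real"
    where "A y = fst y" and "W y = fst (snd y)" and "B y = fst (snd (snd y))" and "Z y = snd (snd (snd y))" for y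
  note comp_defs = A_def W_def B_def Z_def
  have comp_lip: "\<bar>A x - A y\<bar> \<le> dist x y" "\<bar>W x - W y\<bar> \<le> dist x y" "\<bar>B x - B y\<bar> \<le> dist x y" "\<bar>Z x - Z y\<bar> \<le> dist x y" for x y
    unfolding comp_defs dist_real_def[symmetric]
    by (meson dist_fst_le dist_snd_le order_trans)+
  define m0 where "m0 y = (B y - \<epsilon> * A y) / (1 + \<epsilon>\<^sup>2)" for y
  have m0_lip: "\<bar>m0 x - m0 y\<bar> \<le> (1 + \<epsilon>) * dist x y" for x y
  proof -
    have "m0 x - m0 y = ((B x - B y) - \<epsilon> * (A x - A y)) / k"
      unfolding m0_def k_def diff_divide_distrib[symmetric] by (simp add: algebra_simps)
    then have "\<bar>m0 x - m0 y\<bar> \<le> \<bar>(B x - B y) - \<epsilon> * (A x - A y)\<bar>"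
      using k by (simp add: divide_le_eq mult_le_cancel_left1)
    also have "\<dots> \<le> \<bar>B x - B y\<bar> + \<epsilon> * \<bar>A x - A y\<bar>"
      using abs_triangle_ineq4[of "B x - B y" "\<epsilon> * (A x - A y)"] \<epsilon> by (simp add: abs_mult)
    also have "\<dots> \<le> dist x y + \<epsilon> * dist x y"
      using comp_lip \<epsilon> by (intro add_mono mult_left_mono) auto
    finally show ?thesis by (simp add: algebra_simps)
  qed
  define cap where "cap y = max 0 (min M (m0 y))" for y
  \<comment> \<open>The relation \<open>p_eq\<close> with \<open>g\<close> inserted, read as an
    equation for \<open>p\<close>: its left-hand side is strictly increasing, as \<open>k\<close> is
    positive, \<open>cap\<close> is nonnegative and \<open>h\<close> is nondecreasing.\<close>
  define P where "P y = (SOME q. k * q + (\<epsilon> * cap y) * h q = W y + \<epsilon> * Z y)" for y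
  have P: "k * P y + (\<epsilon> * cap y) * h (P y) = W y + \<epsilon> * Z y" for y
    unfolding P_def
    by (rule someI_ex[OF monotone_equation_solvable[OF k _ bounded_lipschitz_continuous[OF h_bl] h(3)]])
      (use \<epsilon> in \<open>auto simp: cap_def\<close>)
  have h_mono: "h q \<le> h q'" if "q \<le> q'" for q q'
    unfolding h_def using that by (intro H1_mono) auto
  have P_lip: "\<bar>P x - P y\<bar> \<le> ((1 + \<epsilon>) + (\<epsilon> * (1 + \<epsilon>)) * Bh) * dist x y" for x y
  proof -
    have "\<bar>P x - P y\<bar> \<le> \<bar>(W x + \<epsilon> * Z x) - (W y + \<epsilon> * Z y)\<bar> + \<bar>\<epsilon> * cap x - \<epsilon> * cap y\<bar> * \<bar>h (P y)\<bar>"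
      by (rule monotone_equation_solution_lipschitz[where h = h, OF k _ h_mono P P]) (use \<epsilon> in \<open>auto simp: cap_def\<close>)
    also have "\<bar>(W x + \<epsilon> * Z x) - (W y + \<epsilon> * Z y)\<bar> \<le> \<bar>W x - W y\<bar> + \<epsilon> * \<bar>Z x - Z y\<bar>"
    proof -
      have "(W x + \<epsilon> * Z x) - (W y + \<epsilon> * Z y) = (W x - W y) + \<epsilon> * (Z x - Z y)" by (simp add: algebra_simps)
      then show ?thesis
        using abs_triangle_ineq[of "W x - W y" "\<epsilon> * (Z x - Z y)"] \<epsilon> by (simp add: abs_mult)
    qed
    also have "\<dots> \<le> dist x y + \<epsilon> * dist x y"
      using comp_lip \<epsilon> by (intro add_mono mult_left_mono) auto
    also have "\<bar>\<epsilon> * cap x - \<epsilon> * cap y\<bar> * \<bar>h (P y)\<bar> \<le> (\<epsilon> * ((1 + \<epsilon>) * dist x y)) * Bh"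
    proof (intro mult_mono h)
      have "\<bar>cap x - cap y\<bar> \<le> \<bar>m0 x - m0 y\<bar>" by (auto simp: cap_def)
      then have "\<bar>cap x - cap y\<bar> \<le> (1 + \<epsilon>) * dist x y" using m0_lip order_trans by blast
      then have "\<epsilon> * \<bar>cap x - cap y\<bar> \<le> \<epsilon> * ((1 + \<epsilon>) * dist x y)" using \<epsilon> by (intro mult_left_mono) auto
      then show "\<bar>\<epsilon> * cap x - \<epsilon> * cap y\<bar> \<le> \<epsilon> * ((1 + \<epsilon>) * dist x y)"
        using \<epsilon> by (simp add: right_diff_distrib[symmetric] abs_mult)
    qed (use \<epsilon> in auto)
    finally show ?thesis by (simp add: algebra_simps)
  qed
  define f0 where "f0 y = max \<delta> (min M (m0 y)) powr \<alpha> - M / max M (m0 y) * H (max (-R) (min R (P y)))" for y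
  define g0 where "g0 y = cap y * h (P y)" for y
  have f0_bl: "bounded_lipschitz f0"
    unfolding f0_def
    by (intro bounded_lipschitz_diff bounded_lipschitz_mult
        bounded_lipschitz_compose[OF powr_bl m0_lip] bounded_lipschitz_compose[OF quot_bl m0_lip]
        bounded_lipschitz_compose[OF Ht_bl P_lip])
  have g0_bl: "bounded_lipschitz g0"
    unfolding g0_def cap_def
    by (intro bounded_lipschitz_mult bounded_lipschitz_compose[OF cap_bl m0_lip]
        bounded_lipschitz_compose[OF h_bl P_lip])
  obtain Bf Lf where f0: "0 \<le> Bf" "0 \<le> Lf" "\<And>q. \<bar>f0 q\<bar> \<le> Bf" "\<And>x y. \<bar>f0 x - f0 y\<bar> \<le> Lf * dist x y"
    by (rule bounded_lipschitzE[OF f0_bl]) (rule that)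
  obtain Bg Lg where g0: "0 \<le> Bg" "0 \<le> Lg" "\<And>q. \<bar>g0 q\<bar> \<le> Bg" "\<And>x y. \<bar>g0 x - g0 y\<bar> \<le> Lg * dist x y"
    by (rule bounded_lipschitzE[OF g0_bl]) (rule that)
  \<comment> \<open>The linear part \<open>J\<close> exchanges \<open>a\<close> with
    \<open>w\<close> and \<open>b\<close> with \<open>z\<close>, hence is an involution;
    \<open>N\<close> collects everything else, including the constant source -1 in the equation for
    \<open>z\<close>.\<close>
  define N where "N t y = (0::real, V t - f0 y, - g0 y, - 1::real)" for t y
  define J where "J y = (W y, A y, Z y, B y)" for y
  have norm4: "norm (x1, x2, x3, x4) \<le> \<bar>x1\<bar> + \<bar>x2\<bar> + \<bar>x3\<bar> + \<bar>x4\<bar>" for x1 x2 x3 x4 :: real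
  proof -
    have "norm (x1, x2, x3, x4) \<le> norm x1 + norm (x2, x3, x4)" by (rule norm_Pair_le)
    also have "norm (x2, x3, x4) \<le> norm x2 + norm (x3, x4)" by (rule norm_Pair_le)
    also have "norm (x3, x4) \<le> norm x3 + norm x4" by (rule norm_Pair_le)
    finally show ?thesis by simp
  qed
  have "\<exists>y. (\<forall>t. y (t + 1) = y t) \<and> (\<forall>t. (y has_vector_derivative J (y t) + N t (y t)) (at t))"
  proof (rule periodic_solution_exists)
    show "bounded_linear J"
      unfolding J_def comp_defs
      by (intro bounded_linear_Pair bounded_linear_fst_comp bounded_linear_snd_comp bounded_linear_ident)
    show "J (J y) = y" for y by (simp add: J_def comp_defs)
    have "continuous_on UNIV (\<lambda>q :: real \<times> real \<times> real \<times> real \<times> real. V (fst q))"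
      by (rule continuous_on_compose2[OF V_cont]) (auto intro: continuous_intros)
    moreover have "continuous_on UNIV (\<lambda>q :: real \<times> real \<times> real \<times> real \<times> real. f0 (snd q))"
      by (rule continuous_on_compose2[OF bounded_lipschitz_continuous[OF f0_bl, of UNIV]]) (auto intro: continuous_intros)
    moreover have "continuous_on UNIV (\<lambda>q :: real \<times> real \<times> real \<times> real \<times> real. g0 (snd q))"
      by (rule continuous_on_compose2[OF bounded_lipschitz_continuous[OF g0_bl, of UNIV]]) (auto intro: continuous_intros)
    ultimately show "continuous_on UNIV (\<lambda>(t, y). N t y)"
      unfolding N_def case_prod_unfold by (intro continuous_intros)
    show "norm (N t x - N t y) \<le> (Lf + Lg) * norm (x - y)" for t x y
    proof -
      have "N t x - N t y = (0, - (f0 x - f0 y), - (g0 x - g0 y), 0)" by (simp add: N_def)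
      then have "norm (N t x - N t y) \<le> \<bar>f0 x - f0 y\<bar> + \<bar>g0 x - g0 y\<bar>"
        using norm4[of 0 "- (f0 x - f0 y)" "- (g0 x - g0 y)" 0] by simp
      also have "\<dots> \<le> Lf * dist x y + Lg * dist x y" using f0(4) g0(4) by (rule add_mono)
      finally show ?thesis by (simp add: dist_norm algebra_simps)
    qed
    show "norm (N t y) \<le> v0 + Bf + Bg + 1" for t y
    proof -
      have "norm (N t y) \<le> \<bar>V t - f0 y\<bar> + \<bar>g0 y\<bar> + 1"
        unfolding N_def using norm4[of 0 "V t - f0 y" "- g0 y" "- 1"] by simp
      then show ?thesis using V_bound[of t] f0(3)[of y] g0(3)[of y] by linarith
    qed
    show "N (t + 1) y = N t y" for t y using V_periodic by (simp add: N_def periodic1_def)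
    show "0 \<le> Lf + Lg" using f0 g0 by simp
  qed
  then obtain y where y_per: "\<And>t. y (t + 1) = y t"
    and y: "\<And>t. (y has_vector_derivative J (y t) + N t (y t)) (at t)" by blast
  have "truncated_mfg H H1 H2 V \<alpha> c0 c1 p0 v0 \<epsilon> \<delta> M R (\<lambda>t. A (y t)) (\<lambda>t. W (y t)) (\<lambda>t. B (y t)) (\<lambda>t. Z (y t))
      (\<lambda>t. P (y t)) (\<lambda>t. m0 (y t)) (\<lambda>t. f0 (y t) - V t) (\<lambda>t. g0 (y t))"
  proof unfold_locales
    fix x
    have lin: "bounded_linear A" "bounded_linear W" "bounded_linear B" "bounded_linear Z"
      unfolding comp_defs
      by (intro bounded_linear_fst_comp bounded_linear_snd_comp bounded_linear_ident)+
    note D = bounded_linear.has_vector_derivative[OF _ y]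
    show "((\<lambda>t. A (y t)) has_real_derivative W (y x)) (at x)"
      using D[OF lin(1), of x] by (simp add: has_real_derivative_iff_has_vector_derivative J_def N_def A_def)
    show "((\<lambda>t. W (y t)) has_real_derivative A (y x) - (f0 (y x) - V x)) (at x)"
      using D[OF lin(2), of x]
      by (simp add: has_real_derivative_iff_has_vector_derivative J_def N_def W_def algebra_simps)
    show "((\<lambda>t. B (y t)) has_real_derivative Z (y x) - g0 (y x)) (at x)"
      using D[OF lin(3), of x] by (simp add: has_real_derivative_iff_has_vector_derivative J_def N_def B_def)
    show "((\<lambda>t. Z (y t)) has_real_derivative B (y x) - 1) (at x)"
      using D[OF lin(4), of x] by (simp add: has_real_derivative_iff_has_vector_derivative J_def N_def Z_def)
    show "(1 + \<epsilon>\<^sup>2) * P (y x) + \<epsilon> * g0 (y x) = W (y x) + \<epsilon> * Z (y x)"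
      using P[of "y x"] by (simp add: k_def g0_def mult.assoc)
  qed (simp_all add: periodic1_def y_per m0_def f0_def g0_def cap_def h_def)
  then show ?thesis by blast
qed

subsection \<open>A priori estimates\<close>

text \<open>The amount by which \<open>\<bar>f\<bar> + \<bar>g\<bar>\<close> can exceed the energy
  density, see \<open>fg_le_energy_density\<close>. It involves none of \<epsilon>, \<delta>,
  \<open>M\<close>, \<open>R\<close>, so these can be chosen after it.\<close>

definition (in mfg_data) forcing_bound :: "real \<Rightarrow> real" where
  "forcing_bound M0 = 2 * M0 powr \<alpha> + (c0 + v0 + 1) * M0 + 2 * c1 + 2 * v0"

text \<open>\<open>M0\<close> marks where the coupling dominates: beyond it the truncated power of
  \<open>m\<close> is at least twice the coefficient \<open>c0 + v0 + 1\<close> of the terms linear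
  in \<open>m\<close>, and \<open>4 \<le> M0\<close> gives \<open>m - 2 \<ge> m / 2\<close>.
  \<open>\<epsilon>_small\<close> serves the sign of \<open>m\<close>, and \<open>p0 \<le> R\<close>
  the sign of the truncated \<open>H1\<close>.\<close>

locale small_truncated_mfg = truncated_mfg +
  fixes M0 :: real
  assumes \<epsilon>: "0 < \<epsilon>" "\<epsilon> \<le> 1" and \<epsilon>_small: "\<epsilon> * (1 + c1 + v0) < 1"
    and \<delta>: "0 < \<delta>" "\<delta> \<le> 1"
    and M0: "4 \<le> M0" "2 * (c0 + v0 + 1) \<le> M0 powr \<alpha>" "M0 \<le> M"
    and R: "p0 \<le> R"
begin

section \<open>Recovering \<open>u\<close>, \<open>m\<close> and their first derivatives from the
  state\<close>

definition u :: "real \<Rightarrow> real" where "u x = (a x + \<epsilon> * b x) / (1 + \<epsilon>\<^sup>2)"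
definition \<mu> :: "real \<Rightarrow> real" where "\<mu> x = (z x - g x - \<epsilon> * w x) / (1 + \<epsilon>\<^sup>2)"
text \<open>Testing the equation for \<open>z\<close> with \<open>u\<close> and the equation for
  \<open>w\<close> with \<open>m - 1\<close>, then subtracting: \<open>\<Phi>\<close> collects the
  boundary terms of the integrations by parts. It is periodic, so the energy density
  \<open>\<Phi>'\<close> has mean zero.\<close>

definition \<Phi> :: "real \<Rightarrow> real" where "\<Phi> x = z x * u x - w x * m x + w x"
definition \<Phi>' :: "real \<Rightarrow> real" where
  "\<Phi>' x = \<epsilon> * ((u x)\<^sup>2 + (m x)\<^sup>2 + (p x)\<^sup>2 + (\<mu> x)\<^sup>2) + g x * p x + f x * m x - f x - \<epsilon> * m x"
abbreviation L1_bound :: real where "L1_bound \<equiv> forcing_bound M0"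
abbreviation \<Lambda> :: real where "\<Lambda> \<equiv> 27 * (forcing_bound M0 + 1)"

lemma k_pos: "0 < 1 + \<epsilon>\<^sup>2" "1 \<le> 1 + \<epsilon>\<^sup>2" by (simp_all add: add_pos_nonneg)

lemma k_nonzero [simp]: "1 + \<epsilon>\<^sup>2 \<noteq> 0" using k_pos(1) by linarith

lemma v0_nonneg: "0 \<le> v0" using V_bound[of 0] by linarith

lemma m_deriv: "(m has_real_derivative \<mu> x) (at x)"
proof -
  have "((\<lambda>x. (b x - \<epsilon> * a x) / (1 + \<epsilon>\<^sup>2)) has_real_derivative (z x - g x - \<epsilon> * w x) / (1 + \<epsilon>\<^sup>2)) (at x)"
    using k_pos by (intro DERIV_cdivide DERIV_diff DERIV_cmult a_deriv b_deriv)
  moreover have "m = (\<lambda>x. (b x - \<epsilon> * a x) / (1 + \<epsilon>\<^sup>2))" using m_eq by (rule ext)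
  ultimately show ?thesis by (simp add: \<mu>_def)
qed

lemma u_deriv: "(u has_real_derivative p x) (at x)"
proof -
  have "(u has_real_derivative (w x + \<epsilon> * (z x - g x)) / (1 + \<epsilon>\<^sup>2)) (at x)"
    unfolding u_def[abs_def] by (intro DERIV_cdivide DERIV_add DERIV_cmult a_deriv b_deriv)
  moreover have "(w x + \<epsilon> * (z x - g x)) / (1 + \<epsilon>\<^sup>2) = p x"
    using p_eq[of x] k_pos by (simp add: divide_eq_eq algebra_simps)
  ultimately show ?thesis by simp
qed

lemma a_via_um: "a x = u x - \<epsilon> * m x"
  and b_via_um: "b x = m x + \<epsilon> * u x"
proof -
  have k: "1 + \<epsilon>\<^sup>2 \<noteq> 0" by simp
  have u: "(1 + \<epsilon>\<^sup>2) * u x = a x + \<epsilon> * b x" and m: "(1 + \<epsilon>\<^sup>2) * m x = b x - \<epsilon> * a x"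
    using k by (simp_all add: u_def m_eq)
  have "(1 + \<epsilon>\<^sup>2) * (u x - \<epsilon> * m x) = (1 + \<epsilon>\<^sup>2) * u x - \<epsilon> * ((1 + \<epsilon>\<^sup>2) * m x)" by (simp add: algebra_simps)
  also have "\<dots> = (1 + \<epsilon>\<^sup>2) * a x" unfolding u m by (simp add: algebra_simps power2_eq_square)
  finally show "a x = u x - \<epsilon> * m x" using k by simp
  have "(1 + \<epsilon>\<^sup>2) * (m x + \<epsilon> * u x) = (1 + \<epsilon>\<^sup>2) * m x + \<epsilon> * ((1 + \<epsilon>\<^sup>2) * u x)" by (simp add: algebra_simps)
  also have "\<dots> = (1 + \<epsilon>\<^sup>2) * b x" unfolding u m by (simp add: algebra_simps power2_eq_square)
  finally show "b x = m x + \<epsilon> * u x" using k by simp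
qed

lemma w_via_p\<mu>: "w x = p x - \<epsilon> * \<mu> x"
  and z_via_p\<mu>: "z x = \<mu> x + \<epsilon> * p x + g x"
proof -
  have k: "1 + \<epsilon>\<^sup>2 \<noteq> 0" by simp
  have p: "(1 + \<epsilon>\<^sup>2) * p x = w x + \<epsilon> * (z x - g x)" using p_eq[of x] by (simp add: algebra_simps)
  have \<mu>: "(1 + \<epsilon>\<^sup>2) * \<mu> x = z x - g x - \<epsilon> * w x" using k by (simp add: \<mu>_def)
  have "(1 + \<epsilon>\<^sup>2) * (p x - \<epsilon> * \<mu> x) = (1 + \<epsilon>\<^sup>2) * p x - \<epsilon> * ((1 + \<epsilon>\<^sup>2) * \<mu> x)" by (simp add: algebra_simps)
  also have "\<dots> = (1 + \<epsilon>\<^sup>2) * w x" unfolding p \<mu> by (simp add: algebra_simps power2_eq_square)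
  finally show "w x = p x - \<epsilon> * \<mu> x" using k by simp
  have "(1 + \<epsilon>\<^sup>2) * (\<mu> x + \<epsilon> * p x) = (1 + \<epsilon>\<^sup>2) * \<mu> x + \<epsilon> * ((1 + \<epsilon>\<^sup>2) * p x)" by (simp add: algebra_simps)
  also have "\<dots> = (1 + \<epsilon>\<^sup>2) * (z x - g x)" unfolding p \<mu> by (simp add: algebra_simps power2_eq_square)
  finally have "\<mu> x + \<epsilon> * p x = z x - g x" using k by simp
  then show "z x = \<mu> x + \<epsilon> * p x + g x" by simp
qed

lemma m_periodic: "periodic1 m" and u_periodic: "periodic1 u"
  using periodic by (simp_all add: periodic1_def m_eq u_def)

lemma m_cont: "continuous_on UNIV m"
  using m_deriv by (intro DERIV_continuous_on) (rule has_field_derivative_at_within)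

text \<open>At a negative minimum of \<open>m\<close> the term \<open>g\<close> vanishes nearby, so that
  \<open>(1 + \<epsilon>\<^sup>2) m'' = (1 + \<epsilon>\<^sup>2) m - 1 + \<epsilon> f < 0\<close>.\<close>

lemma m_nonneg: "0 \<le> m x"
proof -
  obtain x0 where x0: "\<And>y. m x0 \<le> m y"
    using periodic1_attains_minimum[OF m_periodic m_cont] by blast
  have "0 \<le> m x0"
  proof (rule ccontr)
    assume neg: "\<not> 0 \<le> m x0"
    define D where "D = ((b x0 - 1) - \<epsilon> * (a x0 - f x0)) / (1 + \<epsilon>\<^sup>2)"
    \<comment> \<open>The truncated \<open>g\<close> is not known to be differentiable in general;
      on the open set of negative \<open>m\<close> it is zero and drops out of
      \<open>\<mu>\<close>.\<close>
    have "(\<mu> has_real_derivative D) (at x0)"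
    proof (rule has_field_derivative_transform_within_open)
      show "((\<lambda>x. (z x - \<epsilon> * w x) / (1 + \<epsilon>\<^sup>2)) has_real_derivative D) (at x0)"
        unfolding D_def by (intro DERIV_cdivide DERIV_diff DERIV_cmult z_deriv w_deriv)
      show "open {x. m x < 0}" by (intro open_Collect_less m_cont continuous_on_const)
      show "x0 \<in> {x. m x < 0}" using neg by simp
      show "(z x - \<epsilon> * w x) / (1 + \<epsilon>\<^sup>2) = \<mu> x" if "x \<in> {x. m x < 0}" for x
        using that by (simp add: \<mu>_def g_eq)
    qed
    then have "0 \<le> D" using second_derivative_nonneg_at_minimum[OF m_deriv] x0 by blast
    then have D: "0 \<le> (b x0 - 1) - \<epsilon> * (a x0 - f x0)"
      using k_pos by (simp add: D_def zero_le_divide_iff)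
    have "max \<delta> (min M (m x0)) = \<delta>" "max M (m x0) = M" using neg \<delta> M0 by auto
    then have "f x0 = \<delta> powr \<alpha> - H (max (-R) (min R (p x0))) - V x0"
      using M0 by (simp add: f_eq)
    moreover have "\<delta> powr \<alpha> \<le> 1" using powr_mono2[of \<alpha> \<delta> 1] \<delta> \<alpha> by simp
    ultimately have "f x0 \<le> 1 + c1 + v0"
      using H_lower[of "max (-R) (min R (p x0))"] V_bound[of x0] by linarith
    then have "\<epsilon> * f x0 \<le> \<epsilon> * (1 + c1 + v0)" using \<epsilon> by (intro mult_left_mono) auto
    then have "\<epsilon> * f x0 < 1" using \<epsilon>_small by linarith
    moreover have "b x0 - \<epsilon> * a x0 < 0"
    proof -
      have "b x0 - \<epsilon> * a x0 = (1 + \<epsilon>\<^sup>2) * m x0" using k_pos by (simp add: m_eq)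
      then show ?thesis using mult_pos_neg[OF k_pos(1), of "m x0"] neg by simp
    qed
    ultimately show False using D by (simp add: algebra_simps)
  qed
  then show ?thesis using x0 order_trans by blast
qed

section \<open>The energy estimate\<close>

lemma \<Phi>_deriv: "(\<Phi> has_real_derivative \<Phi>' x) (at x)"
proof -
  have "(\<Phi> has_real_derivative ((b x - 1) * u x + p x * z x) - ((a x - f x) * m x + \<mu> x * w x) + (a x - f x)) (at x)"
    unfolding \<Phi>_def[abs_def]
    by (intro DERIV_add DERIV_diff DERIV_mult z_deriv u_deriv w_deriv m_deriv)
  moreover have "((b x - 1) * u x + p x * z x) - ((a x - f x) * m x + \<mu> x * w x) + (a x - f x) = \<Phi>' x"
    using a_via_um[of x] b_via_um[of x] w_via_p\<mu>[of x] z_via_p\<mu>[of x] unfolding \<Phi>'_def by algebra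
  ultimately show ?thesis by simp
qed

text \<open>Where the clamp acts, the removed part \<open>q - r\<close> and \<open>H1 r\<close> have
  the same sign because \<open>p0 \<le> R\<close>, so \<open>q * H1 r\<close> is at least
  \<open>r * H1 r\<close> and \<open>H_legendre\<close> at \<open>r\<close> suffices.\<close>

lemma truncated_legendre:
  "\<bar>H1 (max (-R) (min R q))\<bar> - c0 \<le> q * H1 (max (-R) (min R q)) - H (max (-R) (min R q))"
proof -
  define r where "r = max (-R) (min R q)"
  have "0 \<le> (q - r) * H1 r"
  proof (cases "q < -R \<or> R < q")
    case True
    then show ?thesis
    proof
      assume q: "q < -R"
      then have "r = -R" using R p0 by (auto simp: r_def)
      then have "H1 r \<le> 0" "q - r \<le> 0" using H1_sign(2)[of r] R q by auto
      then show ?thesis by (simp add: mult_nonpos_nonpos)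
    next
      assume q: "R < q"
      then have "r = R" using R p0 by (auto simp: r_def)
      then show ?thesis using H1_sign(1)[of r] R q by auto
    qed
  next
    case False
    then have "r = q" by (auto simp: r_def)
    then show ?thesis by simp
  qed
  then have "r * H1 r \<le> q * H1 r" by (simp add: algebra_simps)
  then show ?thesis using H_legendre[of r] unfolding r_def[symmetric] by linarith
qed

text \<open>Lets the coupling absorb the terms linear in \<open>m\<close>: for \<open>y\<close>
  above \<open>M0\<close> use \<open>y - 2 \<ge> y / 2\<close> and the size of
  \<open>M0 powr \<alpha>\<close>; below, everything is bounded by constants. The factor is
  \<open>y - 2\<close> instead of \<open>y - 1\<close> because one \<theta> is set aside to control
  \<open>\<bar>f\<bar>\<close>.\<close>

lemma coupling_growth:
  assumes "0 \<le> y" and \<theta>: "\<theta> = max \<delta> (min M y) powr \<alpha>"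
  shows "(c0 + v0 + 1) * y - (2 * M0 powr \<alpha> + (c0 + v0 + 1) * M0) \<le> (y - 2) * \<theta>"
proof (cases "M0 \<le> y")
  case True
  define K where "K = c0 + v0 + 1"
  have K: "0 \<le> K" using c0 v0_nonneg by (simp add: K_def)
  have "M0 powr \<alpha> \<le> \<theta>" unfolding \<theta> using True M0 \<alpha> by (intro powr_mono2) auto
  then have "2 * K \<le> \<theta>" using M0 by (simp add: K_def)
  then have "(y / 2) * (2 * K) \<le> (y - 2) * \<theta>" using True M0 K by (intro mult_mono) auto
  moreover have "0 \<le> 2 * M0 powr \<alpha> + K * M0" using K M0 by simp
  ultimately show ?thesis unfolding K_def[symmetric] by (simp add: mult.commute)
next
  case False
  have K: "0 \<le> c0 + v0 + 1" using c0 v0_nonneg by simp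
  have "\<theta> \<le> M0 powr \<alpha>" unfolding \<theta> using False M0 \<alpha> \<delta> by (intro powr_mono2) auto
  moreover have "0 \<le> y * \<theta>" using assms by (simp add: \<theta>)
  moreover have "(c0 + v0 + 1) * y \<le> (c0 + v0 + 1) * M0" using K False by (intro mult_left_mono) auto
  moreover have "(y - 2) * \<theta> = y * \<theta> - 2 * \<theta>" by (simp add: algebra_simps)
  ultimately show ?thesis by linarith
qed

text \<open>Each part of \<open>\<Phi>'\<close> pays for one part of the forcing: the conjugate term
  for \<open>\<bar>g\<bar>\<close>, the leftover \<open>\<psi> * H r\<close> from \<open>- f\<close>
  for the Hamiltonian in \<open>f\<close>, one \<theta> for the coupling in \<open>f\<close>, and
  \<open>(m - 2) * \<theta>\<close> for the errors linear in \<open>m\<close>.\<close>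

lemma fg_le_energy_density: "\<bar>f x\<bar> + \<bar>g x\<bar> \<le> \<Phi>' x + L1_bound"
proof -
  define \<psi> where "\<psi> = M / max M (m x)"
  define r where "r = max (-R) (min R (p x))"
  define \<theta> where "\<theta> = max \<delta> (min M (m x)) powr \<alpha>"
  define c where "c = max 0 (min M (m x))"
  have m0: "0 \<le> m x" by (rule m_nonneg)
  have \<psi>: "0 \<le> \<psi>" "\<psi> \<le> 1" using M0 by (auto simp: \<psi>_def divide_le_eq)
  have c: "0 \<le> c" "c \<le> m x" "c = m x * \<psi>"
    using m0 M0 by (auto simp: c_def \<psi>_def max_def min_def)
  have \<theta>: "0 \<le> \<theta>" by (simp add: \<theta>_def)
  have f: "f x = \<theta> - \<psi> * H r - V x" and g: "g x = c * H1 r"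
    by (simp_all add: f_eq g_eq \<psi>_def r_def \<theta>_def c_def)
  have 1: "\<bar>g x\<bar> - c0 * m x \<le> c * (p x * H1 r - H r)"
  proof -
    have "c * (\<bar>H1 r\<bar> - c0) \<le> c * (p x * H1 r - H r)"
      using truncated_legendre[of "p x"] c unfolding r_def by (intro mult_left_mono) auto
    moreover have "c0 * c \<le> c0 * m x" using c c0 by (intro mult_left_mono) auto
    ultimately show ?thesis using c(1) unfolding g by (simp add: abs_mult algebra_simps)
  qed
  have 2: "\<bar>\<psi> * H r\<bar> - 2 * c1 \<le> \<psi> * H r"
  proof (cases "0 \<le> H r")
    case True
    then show ?thesis using \<psi> c1 by simp
  next
    case False
    then have "H r \<le> \<psi> * H r" using \<psi> by (simp add: mult_le_cancel_right1)
    moreover have "\<psi> * H r \<le> 0" using False \<psi> by (simp add: mult_nonneg_nonpos)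
    ultimately show ?thesis using H_lower[of r] by linarith
  qed
  have 3: "(c0 + v0 + 1) * m x - (2 * M0 powr \<alpha> + (c0 + v0 + 1) * M0) \<le> (m x - 2) * \<theta>"
    by (rule coupling_growth[OF m0 \<theta>_def])
  have 4: "\<bar>f x\<bar> \<le> \<theta> + \<bar>\<psi> * H r\<bar> + v0"
    unfolding f using V_bound[of x] \<theta> by linarith
  have 5: "V x * m x \<le> v0 * m x" using V_bound[of x] m0 by (intro mult_right_mono) auto
  have 6: "\<epsilon> * m x \<le> m x" using mult_right_mono[OF \<epsilon>(2) m0] by simp
  have 7: "0 \<le> \<epsilon> * ((u x)\<^sup>2 + (m x)\<^sup>2 + (p x)\<^sup>2 + (\<mu> x)\<^sup>2)" using \<epsilon> by simp
  \<comment> \<open>Because \<open>c = m x * \<psi>\<close>, the Hamiltonian terms of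
    \<open>g * p\<close> and \<open>f * m\<close> carry the same factor and merge into the conjugate
    of \<open>H\<close>, even where \<open>m\<close> exceeds \<open>M\<close>.\<close>
  have "g x * p x + f x * m x - f x
      = c * (p x * H1 r - H r) + (m x - 1) * \<theta> + \<psi> * H r - V x * m x + V x"
    unfolding f g c(3) by (simp add: algebra_simps)
  then have "\<Phi>' x = \<epsilon> * ((u x)\<^sup>2 + (m x)\<^sup>2 + (p x)\<^sup>2 + (\<mu> x)\<^sup>2) - \<epsilon> * m x
      + c * (p x * H1 r - H r) + (m x - 2) * \<theta> + \<theta> + \<psi> * H r - V x * m x + V x"
    unfolding \<Phi>'_def by (simp add: algebra_simps)
  moreover have "(c0 + v0 + 1) * m x = c0 * m x + v0 * m x + m x" by (simp add: algebra_simps)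
  ultimately show ?thesis
    using 1 2 3 4 5 6 7 V_bound[of x] unfolding forcing_bound_def by linarith
qed

section \<open>Uniform bounds on the state, on \<open>m\<close> and on \<open>p\<close>\<close>

text \<open>The combinations \<open>a \<plusminus> w\<close> and \<open>b \<plusminus> z\<close>
  satisfy scalar linear equations whose sources are controlled by \<open>f\<close>, \<open>g\<close>
  and 1. Their bounds give those of the four components as half-sums and half-differences.\<close>

lemma state_bounds:
  "\<bar>a x\<bar> \<le> \<Lambda>" "\<bar>w x\<bar> \<le> \<Lambda>" "\<bar>b x\<bar> \<le> \<Lambda>" "\<bar>z x\<bar> \<le> \<Lambda>"
proof -
  \<comment> \<open>Over one period \<Phi> contributes nothing, so only the linear term remains; its
    extra 1 covers the constant source in the equation for \<open>z\<close>.\<close>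
  define \<Psi> where "\<Psi> x = \<Phi> x + (L1_bound + 1) * x" for x
  have \<Psi>: "(\<Psi> has_real_derivative \<Phi>' x + (L1_bound + 1)) (at x)" for x
    unfolding \<Psi>_def by (auto intro!: derivative_eq_intros \<Phi>_deriv)
  have per1: "a 1 = a 0" "w 1 = w 0" "b 1 = b 0" "z 1 = z 0" "m 1 = m 0" "u 1 = u 0"
    using periodic m_periodic u_periodic unfolding periodic1_def by (metis add_0)+
  have incr: "\<Psi> 1 - \<Psi> 0 = L1_bound + 1" by (simp add: \<Psi>_def \<Phi>_def per1)
  have unit: "\<bar>a y + \<sigma> * w y\<bar> \<le> \<Lambda> \<and> \<bar>b y + \<sigma> * z y\<bar> \<le> \<Lambda>"
    if \<sigma>: "\<sigma> = 1 \<or> \<sigma> = -1" and y: "0 \<le> y" "y \<le> 1" for \<sigma> y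
  proof
    have s: "((\<lambda>x. a x + \<sigma> * w x) has_real_derivative \<sigma> * (a x + \<sigma> * w x) + (- \<sigma> * f x)) (at x)" for x
    proof -
      have "((\<lambda>x. a x + \<sigma> * w x) has_real_derivative w x + \<sigma> * (a x - f x)) (at x)"
        by (intro DERIV_add DERIV_cmult a_deriv w_deriv)
      moreover have "w x + \<sigma> * (a x - f x) = \<sigma> * (a x + \<sigma> * w x) + (- \<sigma> * f x)"
        using \<sigma> by (auto simp: algebra_simps)
      ultimately show ?thesis by simp
    qed
    have le: "\<bar>- \<sigma> * f x\<bar> \<le> \<Phi>' x + (L1_bound + 1)" for x
      using \<sigma> fg_le_energy_density[of x] by auto
    show "\<bar>a y + \<sigma> * w y\<bar> \<le> \<Lambda>"
      by (rule periodic_linear_ode_bound[OF \<sigma> s \<Psi> le _ incr y]) (simp add: per1)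
    have s: "((\<lambda>x. b x + \<sigma> * z x) has_real_derivative \<sigma> * (b x + \<sigma> * z x) + (- g x - \<sigma>)) (at x)" for x
    proof -
      have "((\<lambda>x. b x + \<sigma> * z x) has_real_derivative (z x - g x) + \<sigma> * (b x - 1)) (at x)"
        by (intro DERIV_add DERIV_cmult b_deriv z_deriv)
      moreover have "(z x - g x) + \<sigma> * (b x - 1) = \<sigma> * (b x + \<sigma> * z x) + (- g x - \<sigma>)"
        using \<sigma> by (auto simp: algebra_simps)
      ultimately show ?thesis by simp
    qed
    have le: "\<bar>- g x - \<sigma>\<bar> \<le> \<Phi>' x + (L1_bound + 1)" for x
      using \<sigma> fg_le_energy_density[of x] by auto
    show "\<bar>b y + \<sigma> * z y\<bar> \<le> \<Lambda>"
      by (rule periodic_linear_ode_bound[OF \<sigma> s \<Psi> le _ incr y]) (simp add: per1)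
  qed
  have eqs: "a x = a (frac x)" "w x = w (frac x)" "b x = b (frac x)" "z x = z (frac x)"
    using periodic by (auto intro: periodic1_frac)
  note bounds = unit[of 1 "frac x", OF _ frac_in_unit] unit[of "-1" "frac x", OF _ frac_in_unit]
  show "\<bar>a x\<bar> \<le> \<Lambda>" "\<bar>w x\<bar> \<le> \<Lambda>" "\<bar>b x\<bar> \<le> \<Lambda>" "\<bar>z x\<bar> \<le> \<Lambda>"
    unfolding eqs using bounds by auto
qed

lemma \<Lambda>_nonneg: "0 \<le> \<Lambda>" using state_bounds(1)[of 0] by linarith

lemma m_upper: "m x \<le> 2 * \<Lambda>"
proof -
  have "\<epsilon> * \<bar>a x\<bar> \<le> 1 * \<Lambda>" using \<epsilon> state_bounds(1)[of x] by (intro mult_mono) auto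
  moreover have "\<bar>\<epsilon> * a x\<bar> = \<epsilon> * \<bar>a x\<bar>" using \<epsilon> by (simp add: abs_mult)
  ultimately have "b x - \<epsilon> * a x \<le> 2 * \<Lambda>" using state_bounds(3)[of x] by linarith
  moreover have "2 * \<Lambda> \<le> (2 * \<Lambda>) * (1 + \<epsilon>\<^sup>2)"
    using mult_left_mono[OF k_pos(2), of "2 * \<Lambda>"] \<Lambda>_nonneg by simp
  ultimately have "b x - \<epsilon> * a x \<le> (2 * \<Lambda>) * (1 + \<epsilon>\<^sup>2)" by linarith
  then show ?thesis unfolding m_eq by (simp only: pos_divide_le_eq[OF k_pos(1)])
qed

text \<open>If \<open>\<bar>p x\<bar>\<close> exceeds \<open>p0\<close>, the truncated slope still
  lies outside the interior of the range from \<open>- p0\<close> to \<open>p0\<close>, so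
  \<open>g x\<close> has the sign of \<open>p x\<close>. Then nothing cancels on the left of
  \<open>p_eq\<close>, and \<open>\<bar>p x\<bar>\<close> is at most
  \<open>\<bar>w x + \<epsilon> * z x\<bar>\<close>.\<close>

lemma p_bound: "\<bar>p x\<bar> \<le> p0 + 2 * \<Lambda>"
proof (rule ccontr)
  assume "\<not> \<bar>p x\<bar> \<le> p0 + 2 * \<Lambda>"
  then have big: "p0 + 2 * \<Lambda> < \<bar>p x\<bar>" by simp
  have "\<epsilon> * \<bar>z x\<bar> \<le> 1 * \<Lambda>" using \<epsilon> state_bounds(4)[of x] by (intro mult_mono) auto
  moreover have "\<bar>\<epsilon> * z x\<bar> = \<epsilon> * \<bar>z x\<bar>" using \<epsilon> by (simp add: abs_mult)
  ultimately have rhs: "\<bar>w x + \<epsilon> * z x\<bar> \<le> 2 * \<Lambda>" using state_bounds(2)[of x] by linarith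
  have kp: "\<bar>p x\<bar> \<le> \<bar>(1 + \<epsilon>\<^sup>2) * p x\<bar>"
    using k_pos by (simp add: abs_mult mult_le_cancel_right1)
  define r where "r = max (-R) (min R (p x))"
  have cap: "0 \<le> max 0 (min M (m x))" by simp
  show False
  proof (cases "0 \<le> p x")
    case True
    then have "p0 \<le> r" using big \<Lambda>_nonneg R p0 by (auto simp: r_def)
    then have "0 \<le> g x" unfolding g_eq r_def[symmetric] using H1_sign(1) by (intro mult_nonneg_nonneg) auto
    then have "0 \<le> \<epsilon> * g x" using \<epsilon> by simp
    moreover have "0 \<le> (1 + \<epsilon>\<^sup>2) * p x" using True k_pos by simp
    ultimately show False using p_eq[of x] rhs kp big p0 True by linarith
  next
    case False
    then have "r \<le> - p0" using big \<Lambda>_nonneg R p0 by (auto simp: r_def)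
    then have "g x \<le> 0" unfolding g_eq r_def[symmetric] using H1_sign(2) by (intro mult_nonneg_nonpos) auto
    then have "\<epsilon> * g x \<le> 0" using \<epsilon> by (simp add: mult_nonneg_nonpos)
    moreover have "(1 + \<epsilon>\<^sup>2) * p x \<le> 0" using False k_pos by (simp add: mult_nonneg_nonpos)
    ultimately show False using p_eq[of x] rhs kp big p0 False by linarith
  qed
qed

end

subsection \<open>Removing the truncation\<close>

definition continuously_differentiable :: "(real \<Rightarrow> real) \<Rightarrow> bool" where
  "continuously_differentiable f \<longleftrightarrow> (\<exists>f'. (\<forall>x. (f has_real_derivative f' x) (at x)) \<and> continuous_on UNIV f')"

lemma C1I: "(\<And>x. (f has_real_derivative f' x) (at x)) \<Longrightarrow> continuous_on UNIV f' \<Longrightarrow> continuously_differentiable f"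
  unfolding continuously_differentiable_def by blast

lemma has_derivative_imp_continuous_on:
  "(\<And>x. (f has_real_derivative f' x) (at x)) \<Longrightarrow> continuous_on S f"
  by (meson DERIV_isCont continuous_at_imp_continuous_on)

lemma C1_imp_continuous_on: "continuously_differentiable f \<Longrightarrow> continuous_on S f"
  unfolding continuously_differentiable_def using has_derivative_imp_continuous_on by blast

lemma C1_const: "continuously_differentiable (\<lambda>x. c)"
  by (rule C1I[of _ "\<lambda>x. 0"]) auto

lemma C1_add:
  assumes "continuously_differentiable f" "continuously_differentiable g" shows "continuously_differentiable (\<lambda>x. f x + g x)"
proof -
  from assms obtain f' g' where f: "\<And>x. (f has_real_derivative f' x) (at x)" "continuous_on UNIV f'"
    and g: "\<And>x. (g has_real_derivative g' x) (at x)" "continuous_on UNIV g'"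
    unfolding continuously_differentiable_def by blast
  show ?thesis by (rule C1I[OF DERIV_add[OF f(1) g(1)]]) (intro continuous_intros f g)
qed

lemma C1_diff:
  assumes "continuously_differentiable f" "continuously_differentiable g" shows "continuously_differentiable (\<lambda>x. f x - g x)"
proof -
  from assms obtain f' g' where f: "\<And>x. (f has_real_derivative f' x) (at x)" "continuous_on UNIV f'"
    and g: "\<And>x. (g has_real_derivative g' x) (at x)" "continuous_on UNIV g'"
    unfolding continuously_differentiable_def by blast
  show ?thesis by (rule C1I[OF DERIV_diff[OF f(1) g(1)]]) (intro continuous_intros f g)
qed

lemma C1_mult:
  assumes "continuously_differentiable f" "continuously_differentiable g" shows "continuously_differentiable (\<lambda>x. f x * g x)"
proof -
  from assms obtain f' g' where f: "\<And>x. (f has_real_derivative f' x) (at x)" "continuous_on UNIV f'"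
    and g: "\<And>x. (g has_real_derivative g' x) (at x)" "continuous_on UNIV g'"
    unfolding continuously_differentiable_def by blast
  show ?thesis
    by (rule C1I[OF DERIV_mult[OF f(1) g(1)]])
      (intro continuous_intros f g C1_imp_continuous_on assms)
qed

lemma C1_divide:
  assumes "continuously_differentiable f" "continuously_differentiable g" and nz: "\<And>x. g x \<noteq> 0" shows "continuously_differentiable (\<lambda>x. f x / g x)"
proof -
  from assms obtain f' g' where f: "\<And>x. (f has_real_derivative f' x) (at x)" "continuous_on UNIV f'"
    and g: "\<And>x. (g has_real_derivative g' x) (at x)" "continuous_on UNIV g'"
    unfolding continuously_differentiable_def by blast
  show ?thesis
    by (rule C1I[OF DERIV_divide[OF f(1) g(1) nz]])
      (intro continuous_intros f g C1_imp_continuous_on assms; use nz in simp)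
qed

lemma C1_compose:
  assumes "\<And>x. (h has_real_derivative h' x) (at x)" "continuous_on UNIV h'" "continuously_differentiable f"
  shows "continuously_differentiable (\<lambda>x. h (f x))"
proof -
  from assms obtain f' where f: "\<And>x. (f has_real_derivative f' x) (at x)" "continuous_on UNIV f'"
    unfolding continuously_differentiable_def by blast
  show ?thesis
  proof (rule C1I)
    show "((\<lambda>x. h (f x)) has_real_derivative h' (f x) * f' x) (at x)" for x
      by (rule DERIV_chain2[OF assms(1) f(1)])
    show "continuous_on UNIV (\<lambda>x. h' (f x) * f' x)"
      by (intro continuous_intros f continuous_on_compose2[OF assms(2) C1_imp_continuous_on[OF assms(3)]]) auto
  qed
qed

lemma C1_powr:
  assumes "continuously_differentiable f" and pos: "\<And>x. 0 < f x"
  shows "continuously_differentiable (\<lambda>x. f x powr r)"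
proof -
  from assms obtain f' where f: "\<And>x. (f has_real_derivative f' x) (at x)" "continuous_on UNIV f'"
    unfolding continuously_differentiable_def by blast
  show ?thesis
  proof (rule C1I)
    show "((\<lambda>x. f x powr r) has_real_derivative r * f x powr (r - 1) * f' x) (at x)" for x
      by (rule DERIV_chain2[OF has_real_derivative_powr[OF pos] f(1)])
    show "continuous_on UNIV (\<lambda>x. r * f x powr (r - 1) * f' x)"
      by (intro continuous_intros f C1_imp_continuous_on assms ballI) (use pos less_irrefl in metis)
  qed
qed

lemma periodic1_derivative:
  assumes "periodic1 f" and f: "\<And>x. (f has_real_derivative f' x) (at x)"
  shows "periodic1 f'"
  unfolding periodic1_def
proof
  fix x
  have "((\<lambda>x. f (x + 1)) has_real_derivative f' (x + 1)) (at x)"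
    using f[of "x + 1"] by (simp add: DERIV_shift)
  then have "(f has_real_derivative f' (x + 1)) (at x)" using assms(1) by (simp add: periodic1_def)
  then show "f' (x + 1) = f' x" using f DERIV_unique by blast
qed

text \<open>Up to distance 1 the Lipschitz bound suffices, since \<open>t \<le> t powr (1/2)\<close>
  there; beyond it boundedness does. Periodicity supplies both bounds.\<close>

lemma C1_periodic_imp_holder_half:
  assumes "continuously_differentiable f" "periodic1 f"
  shows "holder_half f"
proof -
  from assms obtain f' where f: "\<And>x. (f has_real_derivative f' x) (at x)" "continuous_on UNIV f'"
    unfolding continuously_differentiable_def by blast
  obtain B where B: "0 \<le> B" "\<And>x. \<bar>f x\<bar> \<le> B"
    using periodic1_bounded[OF assms(2) C1_imp_continuous_on[OF assms(1)]] by blast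
  obtain L where L: "0 \<le> L" "\<And>x. \<bar>f' x\<bar> \<le> L"
    using periodic1_bounded[OF periodic1_derivative[OF assms(2) f(1)] f(2)] by blast
  have "\<bar>f x - f y\<bar> \<le> (L + 2 * B) * \<bar>x - y\<bar> powr (1/2)" for x y
  proof (cases "\<bar>x - y\<bar> \<le> 1")
    case True
    have "\<bar>f x - f y\<bar> \<le> L * \<bar>x - y\<bar>"
      using field_differentiable_bound[of UNIV f f' L x y] f(1) L(2) by auto
    also have "\<dots> \<le> L * \<bar>x - y\<bar> powr (1/2)"
    proof (intro mult_left_mono L)
      show "\<bar>x - y\<bar> \<le> \<bar>x - y\<bar> powr (1/2)"
        using powr_mono'[of "1/2" 1 "\<bar>x - y\<bar>"] True by simp
    qed
    also have "\<dots> \<le> (L + 2 * B) * \<bar>x - y\<bar> powr (1/2)" using B by (intro mult_right_mono) auto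
    finally show ?thesis .
  next
    case False
    have "\<bar>f x - f y\<bar> \<le> (L + 2 * B) * 1" using B(2)[of x] B(2)[of y] L(1) by simp
    also have "\<dots> \<le> (L + 2 * B) * \<bar>x - y\<bar> powr (1/2)"
      using False B L by (intro mult_left_mono ge_one_powr_ge_zero) auto
    finally show ?thesis .
  qed
  then show ?thesis unfolding holder_half_def by blast
qed

lemma C_k_half_T_2I:
  assumes "periodic1 f" and f: "\<And>x. (f has_real_derivative f1 x) (at x)"
    and f1: "\<And>x. (f1 has_real_derivative f2 x) (at x)" and f2: "continuously_differentiable f2"
  shows "deriv f = f1" "deriv f1 = f2" "C_k 2 f" "C_k_half_T 2 f"
proof -
  show d: "deriv f = f1" "deriv f1 = f2" using f f1 DERIV_imp_deriv by blast+
  have d2: "(deriv ^^ 2) f = f2" by (simp add: numeral_2_eq_2 d)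
  have "((deriv ^^ j) f) differentiable (at x)" if "j < 2" for j x
  proof -
    from that consider "j = 0" | "j = 1" by linarith
    then show ?thesis by cases (use f f1 in \<open>auto simp: d real_differentiable_def\<close>)
  qed
  then show "C_k 2 f" unfolding C_k_def d2 using C1_imp_continuous_on[OF f2] by blast
  moreover have "periodic1 f2" using assms(1) f f1 periodic1_derivative by blast
  ultimately show "C_k_half_T 2 f"
    unfolding C_k_half_T_def d2 using assms(1) C1_periodic_imp_holder_half[OF f2] by blast
qed

section \<open>The system with inactive upper cut-offs\<close>

text \<open>Both conditions can be met because \<Lambda> depends on neither \<open>M\<close> nor
  \<open>R\<close>. Afterwards the only active truncation is the one of \<open>m\<close> from below
  at \<delta>.\<close>

locale untruncated_mfg = small_truncated_mfg +
  assumes M_large: "2 * \<Lambda> \<le> M" and R_large: "p0 + 2 * \<Lambda> \<le> R"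
begin

lemma g_untruncated: "g x = m x * H1 (p x)"
proof -
  have "max 0 (min M (m x)) = m x" using m_nonneg[of x] m_upper[of x] M_large by simp
  moreover have "max (-R) (min R (p x)) = p x" using p_bound[of x] R_large by auto
  ultimately show ?thesis by (simp add: g_eq)
qed

lemma f_semi_untruncated: "f x = max \<delta> (m x) powr \<alpha> - H (p x) - V x"
proof -
  have "min M (m x) = m x" "max M (m x) = M" using m_upper[of x] M_large by auto
  moreover have "max (-R) (min R (p x)) = p x" using p_bound[of x] R_large by auto
  ultimately show ?thesis using M0 by (simp add: f_eq)
qed

text \<open>The derivative of \<open>p\<close>, from implicit differentiation of \<open>(1 +
  \<epsilon>\<^sup>2) * p + \<epsilon> * m * H1 p = w + \<epsilon> * z\<close>.\<close>

definition p1 :: "real \<Rightarrow> real" where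
  "p1 x = (((a x - f x) + \<epsilon> * (b x - 1)) - (\<epsilon> * \<mu> x) * H1 (p x)) / ((1 + \<epsilon>\<^sup>2) + (\<epsilon> * m x) * H2 (p x))"

lemma H2_nonneg: "0 \<le> H2 (p x)" and p_deriv: "(p has_real_derivative p1 x) (at x)"
proof -
  have eq: "(1 + \<epsilon>\<^sup>2) * p y + (\<epsilon> * m y) * H1 (p y) = w y + \<epsilon> * z y" for y
    using p_eq[of y] by (simp add: g_untruncated mult.assoc)
  have s: "((\<lambda>y. w y + \<epsilon> * z y) has_real_derivative (a x - f x) + \<epsilon> * (b x - 1)) (at x)"
    by (intro DERIV_add DERIV_cmult w_deriv z_deriv)
  have c: "((\<lambda>y. \<epsilon> * m y) has_real_derivative \<epsilon> * \<mu> x) (at x)"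
    by (intro DERIV_cmult m_deriv)
  have c0: "0 \<le> \<epsilon> * m y" for y using \<epsilon> m_nonneg[of y] by simp
  note res = monotone_equation_solution_has_derivative[where h = H1, OF k_pos(2) c0 H1_mono eq s c H1_deriv]
  show "0 \<le> H2 (p x)" by (rule res(1))
  show "(p has_real_derivative p1 x) (at x)" unfolding p1_def by (rule res(2))
qed

lemma p1_denominator: "1 \<le> (1 + \<epsilon>\<^sup>2) + (\<epsilon> * m x) * H2 (p x)"
proof -
  have "0 \<le> (\<epsilon> * m x) * H2 (p x)" using \<epsilon> m_nonneg[of x] H2_nonneg[of x] by simp
  then show ?thesis using k_pos(2) by linarith
qed

definition g1 :: "real \<Rightarrow> real" where
  "g1 x = \<mu> x * H1 (p x) + H2 (p x) * p1 x * m x"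

lemma g_deriv: "(g has_real_derivative g1 x) (at x)"
proof -
  have "((\<lambda>x. m x * H1 (p x)) has_real_derivative \<mu> x * H1 (p x) + H2 (p x) * p1 x * m x) (at x)"
    by (intro DERIV_mult m_deriv DERIV_chain2[OF H1_deriv p_deriv])
  moreover have "g = (\<lambda>x. m x * H1 (p x))" using g_untruncated by (rule ext)
  ultimately show ?thesis unfolding g1_def by metis
qed

definition \<mu>1 :: "real \<Rightarrow> real" where
  "\<mu>1 x = ((b x - 1) - g1 x - \<epsilon> * (a x - f x)) / (1 + \<epsilon>\<^sup>2)"

lemma \<mu>_deriv: "(\<mu> has_real_derivative \<mu>1 x) (at x)"
  unfolding \<mu>_def[abs_def] \<mu>1_def
  by (intro DERIV_cdivide DERIV_diff DERIV_cmult z_deriv g_deriv w_deriv)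

text \<open>At a minimum of \<open>m\<close> the term with \<open>\<mu>\<close> in \<open>g1\<close>
  vanishes and the other one is proportional to \<open>m\<close>. With nonnegative second derivative
  the second equation then reads \<open>1 - \<epsilon> * F \<le> (2 + T) * m\<close>. The bound is
  expressed through \<open>F\<close>, \<open>S\<close> and \<Lambda>, so \<delta> can be set equal
  to it.\<close>

lemma m_lower:
  assumes F: "\<And>x. \<bar>f x\<bar> \<le> F" "\<epsilon> * F \<le> 1/2" and S: "\<And>x. H2 (p x) \<le> S"
  shows "1 / (2 * (2 + S * (2 * \<Lambda> + F + 1))) \<le> m x"
proof -
  obtain x0 where x0: "\<And>y. m x0 \<le> m y"
    using periodic1_attains_minimum[OF m_periodic m_cont] by blast
  have \<mu>0: "\<mu> x0 = 0" and "0 \<le> \<mu>1 x0"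
    using second_derivative_nonneg_at_minimum[OF m_deriv \<mu>_deriv x0] by auto
  then have D: "0 \<le> (b x0 - 1) - g1 x0 - \<epsilon> * (a x0 - f x0)"
    unfolding \<mu>1_def by (simp only: pos_le_divide_eq[OF k_pos(1)] mult_zero_left)
  have F0: "0 \<le> F" using F(1)[of 0] by linarith
  have S0: "0 \<le> S" using S[of 0] H2_nonneg[of 0] by linarith
  have p1: "\<bar>p1 x0\<bar> \<le> 2 * \<Lambda> + F + 1"
  proof -
    have "\<bar>p1 x0\<bar> = \<bar>(a x0 - f x0) + \<epsilon> * (b x0 - 1)\<bar> / ((1 + \<epsilon>\<^sup>2) + (\<epsilon> * m x0) * H2 (p x0))"
      using p1_denominator[of x0] by (simp add: p1_def \<mu>0)
    also have "\<dots> \<le> \<bar>(a x0 - f x0) + \<epsilon> * (b x0 - 1)\<bar> / 1"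
      using p1_denominator[of x0] by (intro divide_left_mono) auto
    also have "\<dots> \<le> \<bar>a x0 - f x0\<bar> + \<bar>\<epsilon> * (b x0 - 1)\<bar>"
      unfolding div_by_1 by (rule abs_triangle_ineq)
    also have "\<dots> \<le> (\<Lambda> + F) + 1 * (\<Lambda> + 1)"
    proof (rule add_mono)
      show "\<bar>a x0 - f x0\<bar> \<le> \<Lambda> + F" using state_bounds(1)[of x0] F(1)[of x0] by linarith
      show "\<bar>\<epsilon> * (b x0 - 1)\<bar> \<le> 1 * (\<Lambda> + 1)"
        unfolding abs_mult using \<epsilon> state_bounds(3)[of x0] by (intro mult_mono) auto
    qed
    finally show ?thesis by simp
  qed
  \<comment> \<open>Bounds \<open>H2 * p1\<close> at the minimum, the factor of \<open>m\<close> in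
    \<open>g1\<close>.\<close>
  define T where "T = S * (2 * \<Lambda> + F + 1)"
  have T0: "0 \<le> T" using S0 F0 \<Lambda>_nonneg by (simp add: T_def)
  have g1: "- g1 x0 \<le> T * m x0"
  proof -
    have "\<bar>H2 (p x0) * p1 x0\<bar> \<le> T"
      unfolding abs_mult T_def using H2_nonneg[of x0] S[of x0] p1 S0 by (intro mult_mono) auto
    then have "- (H2 (p x0) * p1 x0) * m x0 \<le> T * m x0"
      using m_nonneg[of x0] by (intro mult_right_mono) auto
    then show ?thesis by (simp add: g1_def \<mu>0)
  qed
  have "\<epsilon> * f x0 \<le> \<epsilon> * F" using F(1)[of x0] \<epsilon> by (intro mult_left_mono) auto
  then have "\<epsilon> * f x0 \<le> 1/2" using F(2) by linarith
  moreover have "b x0 - \<epsilon> * a x0 = (1 + \<epsilon>\<^sup>2) * m x0" by (simp add: m_eq)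
  moreover have "(1 + \<epsilon>\<^sup>2) * m x0 \<le> 2 * m x0"
    using \<epsilon> m_nonneg[of x0] power_le_one[of \<epsilon> 2] by (intro mult_right_mono) auto
  moreover have "0 \<le> (b x0 - \<epsilon> * a x0) - 1 - g1 x0 + \<epsilon> * f x0" using D by (simp add: algebra_simps)
  ultimately have "1/2 \<le> 2 * m x0 + T * m x0" using g1 by linarith
  then have "1 \<le> m x0 * (2 * (2 + T))" by (simp add: algebra_simps)
  then have "1 / (2 * (2 + T)) \<le> m x0" using T0 by (simp add: pos_divide_le_eq)
  then show ?thesis using x0[of x] unfolding T_def by linarith
qed

text \<open>Bootstrap: \<open>p1\<close> is an explicit expression in continuous functions, so
  \<open>p\<close> is \<open>C\<^sup>1\<close>; hence \<open>f\<close>, \<open>H1 (p x)\<close> and,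
  by \<open>H3\<close>, \<open>H2 (p x)\<close> are \<open>C\<^sup>1\<close>, and so are the second
  derivatives \<open>p1\<close> and \<open>\<mu>1\<close>.\<close>

lemma solution_regular:
  assumes lower: "\<And>x. \<delta> \<le> m x"
    and H3: "\<And>p. (H2 has_real_derivative H3 p) (at p)" "continuous_on UNIV H3"
    and V1: "continuously_differentiable V"
  shows "solves_problem1 H V \<alpha> \<epsilon> u m \<and> C_k_half_T 2 u \<and> C_k_half_T 2 m"
proof -
  have f: "f x = m x powr \<alpha> - H (p x) - V x" for x
    using f_semi_untruncated[of x] lower[of x] by (simp add: max_absorb2)
  have m_pos: "0 < m x" for x using lower[of x] \<delta> by linarith
  have H1_cont: "continuous_on S H1" for S by (rule has_derivative_imp_continuous_on[OF H1_deriv])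
  have p_cont: "continuous_on UNIV p" by (rule has_derivative_imp_continuous_on[OF p_deriv])
  have \<mu>_cont: "continuous_on UNIV \<mu>" by (rule has_derivative_imp_continuous_on[OF \<mu>_deriv])
  have f_cont: "continuous_on UNIV f"
  proof -
    have "continuous_on UNIV (\<lambda>x. m x powr \<alpha> - H (p x) - V x)"
      by (intro continuous_intros m_cont V_cont ballI
          continuous_on_compose2[OF has_derivative_imp_continuous_on[OF H_deriv, of UNIV] p_cont])
        (use m_pos less_irrefl in \<open>auto, metis\<close>)
    moreover have "f = (\<lambda>x. m x powr \<alpha> - H (p x) - V x)" using f by (rule ext)
    ultimately show ?thesis by simp
  qed
  have C1_m: "continuously_differentiable m" by (rule C1I[OF m_deriv \<mu>_cont])
  have C1_a: "continuously_differentiable a"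
    by (rule C1I[OF a_deriv]) (rule has_derivative_imp_continuous_on[OF w_deriv])
  have b_cont: "continuous_on UNIV b" by (rule has_derivative_imp_continuous_on[OF b_deriv])
  have a_cont: "continuous_on UNIV a" by (rule has_derivative_imp_continuous_on[OF a_deriv])
  have C1_b: "continuously_differentiable b"
  proof (rule C1I[OF b_deriv])
    show "continuous_on UNIV (\<lambda>x. z x - g x)"
      by (intro continuous_intros has_derivative_imp_continuous_on[OF z_deriv]
          has_derivative_imp_continuous_on[OF g_deriv])
  qed
  have H2p_cont: "continuous_on UNIV (\<lambda>x. H2 (p x))"
    by (rule continuous_on_compose2[OF H2_cont p_cont]) auto
  have H1p_cont: "continuous_on UNIV (\<lambda>x. H1 (p x))"
    by (rule continuous_on_compose2[OF H1_cont[of UNIV] p_cont]) auto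
  have den: "(1 + \<epsilon>\<^sup>2) + (\<epsilon> * m x) * H2 (p x) \<noteq> 0" for x using p1_denominator[of x] by linarith
  have p1_cont: "continuous_on UNIV p1"
    unfolding p1_def[abs_def]
    by (intro continuous_intros a_cont b_cont f_cont \<mu>_cont m_cont H1p_cont H2p_cont ballI den)
  have C1_p: "continuously_differentiable p" by (rule C1I[OF p_deriv p1_cont])
  have C1_H1p: "continuously_differentiable (\<lambda>x. H1 (p x))" by (rule C1_compose[OF H1_deriv H2_cont C1_p])
  have C1_H2p: "continuously_differentiable (\<lambda>x. H2 (p x))" by (rule C1_compose[OF H3 C1_p])
  have C1_f: "continuously_differentiable f"
  proof -
    have "continuously_differentiable (\<lambda>x. m x powr \<alpha> - H (p x) - V x)"
      by (intro C1_diff C1_powr C1_m m_pos V1 C1_compose[OF H_deriv H1_cont C1_p])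
    moreover have "f = (\<lambda>x. m x powr \<alpha> - H (p x) - V x)" using f by (rule ext)
    ultimately show ?thesis by simp
  qed
  have C1_\<mu>: "continuously_differentiable \<mu>"
  proof (rule C1I[OF \<mu>_deriv])
    show "continuous_on UNIV \<mu>1"
      unfolding \<mu>1_def[abs_def] g1_def[abs_def]
      by (intro continuous_intros a_cont b_cont f_cont \<mu>_cont m_cont H1p_cont H2p_cont p1_cont ballI k_nonzero)
  qed
  have C1_p1: "continuously_differentiable p1"
    unfolding p1_def[abs_def]
    by (intro C1_divide C1_diff C1_add C1_mult C1_const C1_a C1_b C1_f C1_\<mu> C1_m C1_H1p C1_H2p den)
  have C1_\<mu>1: "continuously_differentiable \<mu>1"
    unfolding \<mu>1_def[abs_def] g1_def[abs_def]
    by (intro C1_divide C1_diff C1_add C1_mult C1_const C1_a C1_b C1_f C1_\<mu> C1_m C1_H1p C1_H2p C1_p1 k_nonzero)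
  note u_reg = C_k_half_T_2I[OF u_periodic u_deriv p_deriv C1_p1]
  note m_reg = C_k_half_T_2I[OF m_periodic m_deriv \<mu>_deriv C1_\<mu>1]
  \<comment> \<open>Differentiating the explicit formula for \<open>p\<close> in terms of
    \<open>w\<close>, \<open>z\<close>, \<open>g\<close> gives a second expression for
    \<open>p1\<close>; it contains \<open>g1\<close> linearly and so pairs with the formula for
    \<open>\<mu>1\<close>.\<close>
  have p1_eq: "(1 + \<epsilon>\<^sup>2) * p1 x = (a x - f x) + \<epsilon> * (b x - 1 - g1 x)" for x
  proof -
    have "((\<lambda>x. (w x + \<epsilon> * (z x - g x)) / (1 + \<epsilon>\<^sup>2)) has_real_derivative
        ((a x - f x) + \<epsilon> * ((b x - 1) - g1 x)) / (1 + \<epsilon>\<^sup>2)) (at x)"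
      by (intro DERIV_cdivide DERIV_add DERIV_cmult DERIV_diff w_deriv z_deriv g_deriv)
    moreover have "(\<lambda>x. (w x + \<epsilon> * (z x - g x)) / (1 + \<epsilon>\<^sup>2)) = p"
    proof
      fix x
      show "(w x + \<epsilon> * (z x - g x)) / (1 + \<epsilon>\<^sup>2) = p x"
        using p_eq[of x] by (simp add: divide_eq_eq algebra_simps)
    qed
    ultimately have "p1 x = ((a x - f x) + \<epsilon> * ((b x - 1) - g1 x)) / (1 + \<epsilon>\<^sup>2)"
      using p_deriv[of x] DERIV_unique by metis
    then show ?thesis by simp
  qed
  have \<mu>1_eq: "(1 + \<epsilon>\<^sup>2) * \<mu>1 x = (b x - 1 - g1 x) - \<epsilon> * (a x - f x)" for x
    by (simp add: \<mu>1_def)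
  \<comment> \<open>\<open>p1 - \<epsilon> * \<mu>1\<close> and
    \<open>\<mu>1 + \<epsilon> * p1\<close> are the second derivatives of \<open>a\<close> and
    \<open>b\<close>; the factor \<open>1 + \<epsilon>\<^sup>2\<close> is the determinant of this
    change of unknowns.\<close>
  have eq1: "p1 x - \<epsilon> * \<mu>1 x = a x - f x" for x
  proof -
    have "(1 + \<epsilon>\<^sup>2) * (p1 x - \<epsilon> * \<mu>1 x) = (1 + \<epsilon>\<^sup>2) * (a x - f x)"
      using p1_eq[of x] \<mu>1_eq[of x] by algebra
    then show ?thesis using k_nonzero mult_left_cancel by blast
  qed
  have eq2: "\<mu>1 x + \<epsilon> * p1 x = b x - 1 - g1 x" for x
  proof -
    have "(1 + \<epsilon>\<^sup>2) * (\<mu>1 x + \<epsilon> * p1 x) = (1 + \<epsilon>\<^sup>2) * (b x - 1 - g1 x)"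
      using p1_eq[of x] \<mu>1_eq[of x] by algebra
    then show ?thesis using k_nonzero mult_left_cancel by blast
  qed
  have H1: "deriv H = H1" using H_deriv DERIV_imp_deriv by blast
  have "(\<lambda>y. H1 (p y) * m y) = g" using g_untruncated by (simp add: fun_eq_iff mult.commute)
  then have g1: "deriv (\<lambda>y. H1 (p y) * m y) x = g1 x" for x
    using DERIV_imp_deriv[OF g_deriv[of x]] by simp
  have "solves_problem1 H V \<alpha> \<epsilon> u m"
    unfolding solves_problem1_def u_reg(1,2) m_reg(1,2) H1 g1
  proof (intro conjI allI u_periodic m_periodic u_reg m_reg m_pos)
    fix x
    show "u x - p1 x + H (p x) + V x = m x powr \<alpha> + \<epsilon> * (m x - \<mu>1 x)"
      using eq1[of x] a_via_um[of x] f[of x] by (simp add: algebra_simps)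
    show "m x - \<mu>1 x - g1 x = 1 - \<epsilon> * (u x - p1 x)"
      using eq2[of x] b_via_um[of x] by (simp add: algebra_simps)
  qed
  then show ?thesis using u_reg(4) m_reg(4) by blast
qed

end

section \<open>Choice of the constants and conclusion\<close>

text \<open>The constants are fixed in the order \<open>M0\<close>, \<Lambda>, \<open>M\<close> and
  \<open>R\<close>, \<open>F\<close> and \<open>S\<close>, \<delta>, \<open>\<epsilon>0\<close>,
  each depending only on earlier ones and the data; this makes the removal of the truncations free
  of circularity.\<close>

lemma (in mfg_data) problem1_solvable:
  assumes H3: "\<And>p. (H2 has_real_derivative H3 p) (at p)" "continuous_on UNIV H3"
    and V1: "continuously_differentiable V"
  shows "\<exists>\<epsilon>0>0. \<forall>\<epsilon>. 0 < \<epsilon> \<and> \<epsilon> < \<epsilon>0 \<and> \<epsilon> \<le> 1 \<longrightarrow>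
    (\<exists>u m. solves_problem1 H V \<alpha> \<epsilon> u m \<and> C_k_half_T 2 u \<and> C_k_half_T 2 m)"
proof -
  have v0: "0 \<le> v0" using V_bound[of 0] by linarith
  define K where "K = 2 * (c0 + v0 + 1)"
  have K: "0 < K" using c0 v0 by (simp add: K_def)
  define M0 where "M0 = max 4 (K powr (1 / \<alpha>))"
  have "(K powr (1 / \<alpha>)) powr \<alpha> \<le> M0 powr \<alpha>"
    unfolding M0_def using \<alpha> by (intro powr_mono2) auto
  then have M0: "4 \<le> M0" "2 * (c0 + v0 + 1) \<le> M0 powr \<alpha>"
    using \<alpha> K unfolding K_def[symmetric] by (simp_all add: powr_powr M0_def)
  define \<Lambda> where "\<Lambda> = 27 * (forcing_bound M0 + 1)"
  have \<Lambda>: "0 \<le> \<Lambda>" using M0 c0 c1 v0 by (simp add: \<Lambda>_def forcing_bound_def)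
  define M where "M = M0 + 2 * \<Lambda>"
  define R where "R = p0 + 2 * \<Lambda>"
  have R: "0 \<le> R" using p0 \<Lambda> by (simp add: R_def)
  have "compact (H ` {-R..R})" "compact (H2 ` {-R..R})"
    using H2_cont continuous_on_subset has_derivative_imp_continuous_on[OF H_deriv]
    by (auto intro!: compact_continuous_image)
  then have "bounded (H ` {-R..R})" "bounded (H2 ` {-R..R})" by (auto intro: compact_imp_bounded)
  then obtain F0 S where F0: "\<forall>p\<in>{-R..R}. \<bar>H p\<bar> \<le> F0" and S: "\<forall>p\<in>{-R..R}. \<bar>H2 p\<bar> \<le> S"
    by (auto simp: bounded_iff)
  have F0_nonneg: "0 \<le> F0" and S_nonneg: "0 \<le> S"
    using bspec[OF F0, of 0] bspec[OF S, of 0] R by auto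
  \<comment> \<open>Bounds \<open>f\<close> for every \<delta> up to \<open>M\<close>, because
    \<open>max \<delta> (m x)\<close> never exceeds \<open>M\<close>.\<close>
  define F where "F = M powr \<alpha> + F0 + v0"
  have F: "0 \<le> F" using F0_nonneg v0 by (simp add: F_def)
  \<comment> \<open>Exactly the lower bound of \<open>m_lower\<close>, so the cut-off at \<delta>
    turns out to be inactive.\<close>
  define \<delta> where "\<delta> = 1 / (2 * (2 + S * (2 * \<Lambda> + F + 1)))"
  have "0 \<le> S * (2 * \<Lambda> + F + 1)" using S_nonneg \<Lambda> F by simp
  then have \<delta>: "0 < \<delta>" "\<delta> \<le> 1" by (auto simp: \<delta>_def divide_le_eq)
  \<comment> \<open>Serves two smallness conditions: \<open>\<epsilon> * F \<le> 1/2\<close> for the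
    lower bound on \<open>m\<close>, and \<open>\<epsilon> * (1 + c1 + v0) < 1\<close> for its
    nonnegativity.\<close>
  define \<epsilon>0 where "\<epsilon>0 = 1 / (2 * (F + 1 + c1 + v0))"
  have den: "0 < F + 1 + c1 + v0" using F c1 v0 by simp
  show ?thesis
  proof (intro exI[of _ \<epsilon>0] conjI allI impI)
    show "0 < \<epsilon>0" using den by (simp add: \<epsilon>0_def)
    fix \<epsilon> :: real assume "0 < \<epsilon> \<and> \<epsilon> < \<epsilon>0 \<and> \<epsilon> \<le> 1"
    then have \<epsilon>: "0 < \<epsilon>" "\<epsilon> \<le> 1" and small: "\<epsilon> < \<epsilon>0" by auto
    have "\<epsilon> * (F + 1 + c1 + v0) < 1/2" using small den by (simp add: \<epsilon>0_def field_simps)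
    moreover have "\<epsilon> * F \<le> \<epsilon> * (F + 1 + c1 + v0)" "\<epsilon> * (1 + c1 + v0) \<le> \<epsilon> * (F + 1 + c1 + v0)"
      using \<epsilon> F c1 v0 by (auto intro!: mult_left_mono)
    ultimately have \<epsilon>F: "\<epsilon> * F \<le> 1/2" and \<epsilon>_small: "\<epsilon> * (1 + c1 + v0) < 1" by linarith+
    have \<delta>M: "\<delta> \<le> M" using \<delta> M0 \<Lambda> by (simp add: M_def)
    obtain a w b z p m f g where "truncated_mfg H H1 H2 V \<alpha> c0 c1 p0 v0 \<epsilon> \<delta> M R a w b z p m f g"
      using truncated_mfg_solvable[OF \<epsilon>(1) \<delta>(1) \<delta>M R] by blast
    then interpret truncated_mfg H H1 H2 V \<alpha> c0 c1 p0 v0 \<epsilon> \<delta> M R a w b z p m f g .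
    interpret untruncated_mfg H H1 H2 V \<alpha> c0 c1 p0 v0 \<epsilon> \<delta> M R a w b z p m f g M0
      by unfold_locales (use \<epsilon> \<epsilon>_small \<delta> M0 \<Lambda> in \<open>auto simp: M_def R_def \<Lambda>_def\<close>)
    have p_in: "p x \<in> {-R..R}" for x using p_bound[of x] by (auto simp: R_def \<Lambda>_def)
    have "\<bar>f x\<bar> \<le> F" for x
    proof -
      have "max \<delta> (m x) powr \<alpha> \<le> M powr \<alpha>"
        using m_upper[of x] M0 \<delta>M \<delta> \<alpha> by (intro powr_mono2) (auto simp: M_def \<Lambda>_def)
      moreover have "0 \<le> max \<delta> (m x) powr \<alpha>" by simp
      ultimately show ?thesis
        using bspec[OF F0 p_in[of x]] V_bound[of x] unfolding f_semi_untruncated F_def by linarith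
    qed
    moreover have "H2 (p x) \<le> S" for x using bspec[OF S p_in[of x]] by simp
    ultimately have "\<delta> \<le> m x" for x using m_lower[of F S x] \<epsilon>F by (simp add: \<delta>_def \<Lambda>_def)
    from solution_regular[OF this H3 V1]
    show "\<exists>u m. solves_problem1 H V \<alpha> \<epsilon> u m \<and> C_k_half_T 2 u \<and> C_k_half_T 2 m" by blast
  qed
qed

theorem theorem1:
  fixes H V :: "real \<Rightarrow> real" and \<alpha> \<gamma> C1 C2 C3 D1 D2 D3 Cbar :: real
  assumes H_C2: "C_k 2 H"
    and V_per: "periodic1 V" and V_cont: "continuous_on UNIV V"
    and alpha_pos: "\<alpha> > 0"
    and A1: "C1 > 0" "C2 > 0" "C3 > 0" "\<gamma> > 1"
      "\<And>p. - C1 + C2 * \<bar>p\<bar> powr \<gamma> \<le> H p \<and> H p \<le> C1 + C3 * \<bar>p\<bar> powr \<gamma>"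
    and A2: "D1 > 0" "D2 > 0" "D3 > 0"
      "\<And>p. - D1 + D2 * \<bar>p\<bar> powr \<gamma> \<le> p * deriv H p - H p
            \<and> p * deriv H p - H p \<le> D1 + D3 * \<bar>p\<bar> powr \<gamma>"
    and A3: "C_k 2 V"
    and A4: "convex_on UNIV H"
    and A5: "C_k 4 H"
    and A6: "\<gamma> < 2"
    and A7: "Cbar > 0" "\<And>p. \<bar>deriv H p\<bar> \<le> Cbar * (1 + \<bar>p\<bar> powr (\<gamma> - 1))"
  shows "\<exists>\<epsilon>0 > 0. \<forall>\<epsilon>. 0 < \<epsilon> \<and> \<epsilon> < \<epsilon>0 \<and> \<epsilon> \<le> 1 \<longrightarrow>
           (\<exists>u m. solves_problem1 H V \<alpha> \<epsilon> u m \<and> C_k_half_T 2 u \<and> C_k_half_T 2 m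
                  \<and> (\<forall>x. m x > 0))"
proof -
  define Hd where "Hd j = (deriv ^^ j) H" for j
  have Hd: "(Hd j has_real_derivative Hd (Suc j) p) (at p)" if "j < 4" for j p
    using A5 that by (simp add: Hd_def C_k_def DERIV_deriv_iff_real_differentiable)
  have H0: "Hd 0 = H" by (simp add: Hd_def)
  have H_deriv: "(H has_real_derivative Hd 1 p) (at p)" for p using Hd[of 0 p] by (simp add: H0)
  have H1_deriv: "(Hd 1 has_real_derivative Hd 2 p) (at p)" for p using Hd[of 1 p] by (simp add: numeral_2_eq_2)
  have H2_deriv: "(Hd 2 has_real_derivative Hd 3 p) (at p)" for p
    using Hd[of 2 p] by (simp add: numeral_3_eq_3 numeral_2_eq_2)
  have H3_cont: "continuous_on UNIV (Hd 3)"
    by (rule has_derivative_imp_continuous_on[OF Hd]) simp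
  have V_deriv: "(V has_real_derivative deriv V x) (at x)"
    and V1_deriv: "(deriv V has_real_derivative deriv (deriv V) x) (at x)" for x
  proof -
    have "((deriv ^^ j) V) differentiable (at x)" if "j < 2" for j using A3 that by (simp add: C_k_def)
    from this[of 0] this[of 1] show "(V has_real_derivative deriv V x) (at x)"
      "(deriv V has_real_derivative deriv (deriv V) x) (at x)"
      by (simp_all add: DERIV_deriv_iff_real_differentiable)
  qed
  have V1: "continuously_differentiable V"
    by (rule C1I[OF V_deriv has_derivative_imp_continuous_on[OF V1_deriv]])
  obtain v0 where v0: "\<And>x. \<bar>V x\<bar> \<le> v0" using periodic1_bounded[OF V_per V_cont] by blast
  have tangent: "H p + Hd 1 p * (q - p) \<le> H q" for p q
    using convex_on_imp_above_tangent[OF A4, of p q "Hd 1 p"] H_deriv[of p] by simp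
  have H_lower: "- C1 + C2 * \<bar>p\<bar> powr \<gamma> \<le> H p" for p using A1(5) by blast
  \<comment> \<open>Beyond \<open>p0\<close> the coercive lower bound exceeds \<open>H 0\<close>.
    The tangent at \<open>p\<close>, evaluated at 0, then shows that \<open>p * H'(p)\<close> is
    nonnegative.\<close>
  define p0 where "p0 = max 1 ((C1 + \<bar>H 0\<bar>) / C2)"
  have sign: "0 \<le> p * Hd 1 p" if "p0 \<le> \<bar>p\<bar>" for p
  proof -
    have "1 \<le> \<bar>p\<bar>" and "(C1 + \<bar>H 0\<bar>) / C2 \<le> \<bar>p\<bar>" using that by (auto simp: p0_def)
    moreover have "\<bar>p\<bar> powr 1 \<le> \<bar>p\<bar> powr \<gamma>" using \<open>1 \<le> \<bar>p\<bar>\<close> A1(4) by (intro powr_mono) auto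
    ultimately have "C1 + \<bar>H 0\<bar> \<le> C2 * \<bar>p\<bar>" "C2 * \<bar>p\<bar> \<le> C2 * \<bar>p\<bar> powr \<gamma>"
      using A1(2) by (auto simp: pos_divide_le_eq mult.commute intro: mult_left_mono)
    then have "H 0 \<le> H p" using H_lower[of p] by linarith
    then show ?thesis using tangent[of p 0] by (simp add: mult.commute)
  qed
  \<comment> \<open>The constant \<open>\<bar>H 1\<bar> + \<bar>H (-1)\<bar>\<close> comes from
    evaluating the tangent at \<open>p\<close> in the points 1 and -1, which bounds
    \<open>\<bar>H'(p)\<bar>\<close> by the conjugate term.\<close>
  interpret mfg_data H "Hd 1" "Hd 2" V \<alpha> "\<bar>H 1\<bar> + \<bar>H (-1)\<bar>" C1 p0 v0
  proof unfold_locales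
    show "continuous_on UNIV (Hd 2)" by (rule has_derivative_imp_continuous_on[OF H2_deriv])
    show "Hd 1 p \<le> Hd 1 q" if "p \<le> q" for p q
    proof (cases "p = q")
      case False
      have "(Hd 1 p - Hd 1 q) * (q - p) \<le> 0"
        using tangent[of p q] tangent[of q p] by (simp add: algebra_simps)
      then show ?thesis using False that by (simp add: mult_le_0_iff)
    qed simp
    show "- C1 \<le> H p" for p
    proof -
      have "0 \<le> C2 * \<bar>p\<bar> powr \<gamma>" using A1(2) by simp
      then show ?thesis using H_lower[of p] by linarith
    qed
    show "\<bar>Hd 1 p\<bar> - (\<bar>H 1\<bar> + \<bar>H (-1)\<bar>) \<le> p * Hd 1 p - H p" for p
    proof -
      have "H p + Hd 1 p - p * Hd 1 p \<le> H 1" "H p - Hd 1 p - p * Hd 1 p \<le> H (-1)"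
        using tangent[of p 1] tangent[of p "-1"] by (simp_all add: algebra_simps)
      then show ?thesis by linarith
    qed
    have p0: "1 \<le> p0" by (simp add: p0_def)
    then show "0 \<le> p0" by simp
    show "0 \<le> Hd 1 p" if "p0 \<le> p" for p
      using sign[of p] that p0 by (simp add: zero_le_mult_iff)
    show "Hd 1 p \<le> 0" if "p \<le> - p0" for p
      using sign[of p] that p0 by (simp add: zero_le_mult_iff)
  qed (rule H_deriv H1_deriv V_per V_cont v0 alpha_pos less_imp_le[OF A1(1)] add_nonneg_nonneg abs_ge_zero)+
  have "\<forall>x. 0 < m x" if "solves_problem1 H V \<alpha> \<epsilon> u m" for \<epsilon> u m
    using that unfolding solves_problem1_def by simp
  with problem1_solvable[OF H2_deriv H3_cont V1] show ?thesis by meson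
qed

end
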